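(* Assume that $B^H_t=\int_0^tG^H(t,s)\,dB_s$, where $G^H$ is the Volterra kernel of fractional Brownian motion and $B$ is the same Brownian motion that appears in $N_t$. Let $\eta_1>0$ be the constant in the growth condition $g(x,u)\ge\eta_1(\lambda\zeta(x)u^{-2}-\gamma u)$, let $$\tau^*:=\inf\left\{t>0:\ \int_0^t e^{-3(\eta_1\gamma s-\mu_1K(s)-A(s))+3N_s}\,ds\ \ge\ \frac{\langle v_0,\psi_1\rangle_D^3}{3\lambda\eta_1\zeta_m}\right\},$$ and let $$\nu(T):=\int_0^T\exp\left[-3(\gamma\eta_1t-\mu_1K(t)-A(t))\right]\,\mathbb E\left[e^{3N_t}\right]dt .$$ Then, for any $T>0$ such that $\frac{\langle v_0,\psi_1\rangle_D^3}{3\lambda\eta_1\zeta_m}>\nu(T)$, $$\mathbb P[\tau^*\le T]\le 2\exp\left(-\frac{\ln^2\left[\frac{\langle v_0,\psi_1\rangle_D^{3}}{3\lambda\eta_1\zeta_m\,\nu(T)}\right]}{2M(T)}\right),$$ where $$M(T):=18\int_0^Ta^2(s)\,ds+36\,H\,T^{2H-1}\int_0^Tb^2(s)\,ds .$$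
   Context: Setting. $D\subset\mathbb R^d$ is an open set with compact Lipschitz boundary, $D^c=\mathbb R^d\setminus D$, $\langle\cdot,\cdot\rangle_D$ is the $L^2(D)$ inner product. $\nu_0:\mathbb R^d\setminus\{0\}\to[0,\infty)$ (unrelated to the function $\nu(T)$ of the claim) is the density of a symmetric Lévy measure, and $\mathcal Lu(x)=\mathrm{p.v.}\int_{\mathbb R^d}(u(x)-u(y))\nu_0(x-y)\,dy$, $\mathcal Nu(y)=\int_D(u(y)-u(x))\nu_0(x-y)\,dx$ for $y\in D^c$. The function $\beta:D^c\to(0,\infty)$ is such that $\beta\tilde\nu^{-1}$ is essentially bounded and non-trivial, where $\tilde\nu(x)=\int_B\min(1,\nu_0(x-y))\,dy$ for a bounded open set $B$. $(\mu_1,\psi_1)$ is the first eigenpair of $\mathcal L\psi=\mu\psi$ in $D$, $\mathcal N\psi+\beta\psi=0$ on $D^c$; $\mu_1>0$, $\psi_1>0$ and $\int_D\psi_1\,dx=1$. Noise: on a filtered probability space, $B$ is a real Brownian motion and $B^H$ a real fractional Brownian motion with Hurst index $H\in(1/2,1)$; $a(\cdot),b(\cdot),k(\cdot)$ are positive functions of time; $N_t=\int_0^ta(s)\,dB_s+\int_0^tb(s)\,dB^H_s$ (Itô integral with respect to $B$, pathwise Riemann–Stieltjes/Young integral with respect to $B^H$). $K(t)=\frac12\int_0^tk^2(s)\,ds$, $A(t)=\frac12\int_0^ta^2(s)\,ds$. Volterra kernel: $G^H(t,s)=C_Hs^{1/2-H}\int_s^t(\sigma-s)^{H-3/2}\sigma^{H-1/2}\,d\sigma$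 for $t>s$, and $G^H(t,s)=0$ for $t\le s$, with $C_H=\left[\frac{H(2H-1)}{\mathcal B(2-2H,H-1/2)}\right]^{1/2}$, $\mathcal B$ the beta function. $\lambda,\gamma>0$ are constants, $\zeta>0$ is a function on $\bar D$, $\zeta_m=\min_{\bar D}\zeta>0$; $v_0=z_0$ is the initial datum, $0\le z_0<1$. (Here $g$ is the nonlinearity of $dz=(-\frac12k^2\mathcal Lz-g(x,z))dt-z\,dN_t$, for which $\tau^*$ is an upper bound of the quenching time.) *)

theory Defs
  imports "HOL-Probability.Probability"
begin

section \<open>Domains and nonlocal operators\<close>

text \<open>Near each boundary point, \<open>D\<close> is the region above the graph, in some direction \<open>e\<close>, of a
  Lipschitz function \<open>f\<close> on the hyperplane orthogonal to \<open>e\<close>.\<close>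

definition lipschitz_boundary :: "'d::euclidean_space set \<Rightarrow> bool" where
  "lipschitz_boundary D \<longleftrightarrow>
    (\<forall>p\<in>frontier D. \<exists>r>0. \<exists>e f L. norm e = 1 \<and> L-lipschitz_on {y. y \<bullet> e = 0} f \<and>
       D \<inter> ball p r = {x \<in> ball p r. f (x - (x \<bullet> e) *\<^sub>R e) < x \<bullet> e})"

text \<open>The value of the density at the origin is irrelevant.\<close>

definition symmetric_levy_density :: "('d::euclidean_space \<Rightarrow> real) \<Rightarrow> bool" where
  "symmetric_levy_density \<nu>0 \<longleftrightarrow>
     \<nu>0 \<in> borel_measurable borel \<and>
     (\<forall>h. h \<noteq> 0 \<longrightarrow> 0 \<le> \<nu>0 h \<and> \<nu>0 (- h) = \<nu>0 h) \<and>
     (\<integral>\<^sup>+h. ennreal (min 1 ((norm h)\<^sup>2) * \<nu>0 h) \<partial>lborel) < \<infinity>"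

definition levy_op :: "('d::euclidean_space \<Rightarrow> real) \<Rightarrow> ('d \<Rightarrow> real) \<Rightarrow> 'd \<Rightarrow> real" where
  "levy_op \<nu>0 u x =
     Lim (at_right 0) (\<lambda>\<epsilon>. LINT y:{y. \<epsilon> < dist x y}|lborel. (u x - u y) * \<nu>0 (x - y))"

definition neumann_op ::
  "('d::euclidean_space \<Rightarrow> real) \<Rightarrow> 'd set \<Rightarrow> ('d \<Rightarrow> real) \<Rightarrow> 'd \<Rightarrow> real" where
  "neumann_op \<nu>0 D u y = (LINT x:D|lborel. (u y - u x) * \<nu>0 (x - y))"

definition nu_tilde :: "('d::euclidean_space \<Rightarrow> real) \<Rightarrow> 'd set \<Rightarrow> 'd \<Rightarrow> real" where
  "nu_tilde \<nu>0 U x = (LINT y:U|lborel. min 1 (\<nu>0 (x - y)))"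

definition robin_coefficient ::
  "('d::euclidean_space \<Rightarrow> real) \<Rightarrow> 'd set \<Rightarrow> 'd set \<Rightarrow> ('d \<Rightarrow> real) \<Rightarrow> bool" where
  "robin_coefficient \<nu>0 D U \<beta> \<longleftrightarrow>
     set_borel_measurable lborel (- D) \<beta> \<and> (\<forall>y\<in>- D. 0 < \<beta> y) \<and>
     (\<exists>C. AE y in lborel. y \<in> - D \<longrightarrow> 0 < nu_tilde \<nu>0 U y \<and> \<beta> y / nu_tilde \<nu>0 U y \<le> C) \<and>
     \<not> (AE y in lborel. y \<in> - D \<longrightarrow> \<beta> y / nu_tilde \<nu>0 U y = 0)"

definition L2_inner :: "'d::euclidean_space set \<Rightarrow> ('d \<Rightarrow> real) \<Rightarrow> ('d \<Rightarrow> real) \<Rightarrow> real" where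
  "L2_inner D u v = (LINT x:D|lborel. u x * v x)"

section \<open>The Robin eigenvalue problem\<close>

text \<open>The energy only sees pairs of points that are not both in the complement of \<open>D\<close>.\<close>

definition finite_energy ::
  "('d::euclidean_space \<Rightarrow> real) \<Rightarrow> 'd set \<Rightarrow> ('d \<Rightarrow> real) \<Rightarrow> ('d \<Rightarrow> real) \<Rightarrow> bool" where
  "finite_energy \<nu>0 D \<beta> u \<longleftrightarrow>
     u \<in> borel_measurable borel \<and>
     (\<integral>\<^sup>+x\<in>D. ennreal ((u x)\<^sup>2) \<partial>lborel) < \<infinity> \<and>
     (\<integral>\<^sup>+x. \<integral>\<^sup>+y. ennreal ((u x - u y)\<^sup>2 * \<nu>0 (x - y)) *
        indicator {(x, y). x \<in> D \<or> y \<in> D} (x, y) \<partial>lborel \<partial>lborel) < \<infinity> \<and>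
     (\<integral>\<^sup>+y\<in>- D. ennreal (\<beta> y * (u y)\<^sup>2) \<partial>lborel) < \<infinity>"

primrec Ck :: "nat \<Rightarrow> ('d::euclidean_space \<Rightarrow> real) \<Rightarrow> bool" where
  "Ck 0 f \<longleftrightarrow> continuous_on UNIV f"
| "Ck (Suc n) f \<longleftrightarrow> f differentiable_on UNIV \<and>
     (\<forall>e\<in>Basis. Ck n (\<lambda>x. frechet_derivative f (at x) e))"

definition test_function :: "('d::euclidean_space \<Rightarrow> real) \<Rightarrow> bool" where
  "test_function \<phi> \<longleftrightarrow> (\<forall>n. Ck n \<phi>) \<and> compact (closure {x. \<phi> x \<noteq> 0})"

text \<open>The problem \<open>L \<psi> = \<mu> \<psi>\<close> in \<open>D\<close>, \<open>N \<psi> + \<beta> \<psi> = 0\<close> on the complement of \<open>D\<close>, in the weak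
  sense: multiply by a test function \<open>\<phi>\<close>, add the two equations and use the nonlocal Green formula
  \<open>\<integral>\<^sub>D (L \<psi>) \<phi> + \<integral>\<^sub>D\<^sub>c (N \<psi>) \<phi> = \<integral>\<^sub>D \<psi> (L \<phi>) + \<integral>\<^sub>D\<^sub>c \<psi> (N \<phi>)\<close> (here \<open>Dc\<close> is the complement) to
  put both operators on \<open>\<phi>\<close>. The pointwise reading would not determine a spectrum: it does not see
  sources carried by the boundary of \<open>D\<close> or, for strongly singular kernels, by points.\<close>

definition robin_eigenpair ::
  "('d::euclidean_space \<Rightarrow> real) \<Rightarrow> 'd set \<Rightarrow> ('d \<Rightarrow> real) \<Rightarrow> real \<Rightarrow> ('d \<Rightarrow> real) \<Rightarrow> bool" where
  "robin_eigenpair \<nu>0 D \<beta> \<mu> \<psi> \<longleftrightarrow>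
     finite_energy \<nu>0 D \<beta> \<psi> \<and>
     \<not> (AE x in lborel. x \<in> D \<longrightarrow> \<psi> x = 0) \<and>
     (\<forall>\<phi>. test_function \<phi> \<longrightarrow>
        set_integrable lborel D (\<lambda>x. \<psi> x * levy_op \<nu>0 \<phi> x) \<and>
        set_integrable lborel (- D) (\<lambda>y. \<psi> y * (neumann_op \<nu>0 D \<phi> y + \<beta> y * \<phi> y)) \<and>
        L2_inner D \<psi> (levy_op \<nu>0 \<phi>) +
          L2_inner (- D) \<psi> (\<lambda>y. neumann_op \<nu>0 D \<phi> y + \<beta> y * \<phi> y) = \<mu> * L2_inner D \<psi> \<phi>)"

definition first_robin_eigenpair ::
  "('d::euclidean_space \<Rightarrow> real) \<Rightarrow> 'd set \<Rightarrow> ('d \<Rightarrow> real) \<Rightarrow> real \<Rightarrow> ('d \<Rightarrow> real) \<Rightarrow> bool" where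
  "first_robin_eigenpair \<nu>0 D \<beta> \<mu>1 \<psi>1 \<longleftrightarrow>
     robin_eigenpair \<nu>0 D \<beta> \<mu>1 \<psi>1 \<and> (\<forall>\<mu> \<psi>. robin_eigenpair \<nu>0 D \<beta> \<mu> \<psi> \<longrightarrow> \<mu>1 \<le> \<mu>)"

section \<open>Brownian motion and fractional Brownian motion\<close>

text \<open>Processes and filtrations are indexed by \<open>real\<close>, since the library has no type of nonnegative
  times; only the indices \<open>t \<ge> 0\<close> are ever used.\<close>

definition filtered_prob_space :: "'w measure \<Rightarrow> (real \<Rightarrow> 'w measure) \<Rightarrow> bool" where
  "filtered_prob_space M F \<longleftrightarrow>
     prob_space M \<and> filtration (space M) F \<and> (\<forall>t. sets (F t) \<subseteq> sets M)"

definition brownian_motion ::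
  "'w measure \<Rightarrow> (real \<Rightarrow> 'w measure) \<Rightarrow> (real \<Rightarrow> 'w \<Rightarrow> real) \<Rightarrow> bool" where
  "brownian_motion M F B \<longleftrightarrow>
     (\<forall>t\<ge>0. B t \<in> borel_measurable (F t)) \<and>
     (AE \<omega> in M. B 0 \<omega> = 0) \<and>
     (AE \<omega> in M. continuous_on {0..} (\<lambda>t. B t \<omega>)) \<and>
     (\<forall>s t. 0 \<le> s \<and> s < t \<longrightarrow>
        distributed M lborel (\<lambda>\<omega>. B t \<omega> - B s \<omega>) (normal_density 0 (sqrt (t - s))) \<and>
        prob_space.indep_set M (sets (F s))
          (sets (vimage_algebra (space M) (\<lambda>\<omega>. B t \<omega> - B s \<omega>) borel)))"

text \<open>A centred Gaussian variable with variance \<open>v\<close>; variance zero is allowed.\<close>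

definition centred_gaussian :: "'w measure \<Rightarrow> ('w \<Rightarrow> real) \<Rightarrow> real \<Rightarrow> bool" where
  "centred_gaussian M X v \<longleftrightarrow>
     X \<in> borel_measurable M \<and>
     (0 < v \<and> distributed M lborel X (normal_density 0 (sqrt v)) \<or> v = 0 \<and> (AE \<omega> in M. X \<omega> = 0))"

definition centred_gaussian_process ::
  "'w measure \<Rightarrow> (real \<Rightarrow> 'w \<Rightarrow> real) \<Rightarrow> (real \<Rightarrow> real \<Rightarrow> real) \<Rightarrow> bool" where
  "centred_gaussian_process M X R \<longleftrightarrow>
     (\<forall>S c. finite S \<and> S \<subseteq> {0..} \<longrightarrow>
        centred_gaussian M (\<lambda>\<omega>. \<Sum>t\<in>S. c t * X t \<omega>) (\<Sum>s\<in>S. \<Sum>t\<in>S. c s * c t * R s t))"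

definition fractional_brownian_motion :: "'w measure \<Rightarrow> real \<Rightarrow> (real \<Rightarrow> 'w \<Rightarrow> real) \<Rightarrow> bool" where
  "fractional_brownian_motion M H X \<longleftrightarrow>
     centred_gaussian_process M X
       (\<lambda>s t. (s powr (2 * H) + t powr (2 * H) - \<bar>t - s\<bar> powr (2 * H)) / 2) \<and>
     (AE \<omega> in M. continuous_on {0..} (\<lambda>t. X t \<omega>))"

section \<open>Stochastic and pathwise integrals\<close>

text \<open>A simple integrand \<open>\<Sum>i<n. \<xi> i \<cdot> indicator {p i<..p (i+1)}\<close>.\<close>

definition simple_integrand ::
  "'w measure \<Rightarrow> (real \<Rightarrow> 'w measure) \<Rightarrow> nat \<Rightarrow> (nat \<Rightarrow> real) \<Rightarrow> (nat \<Rightarrow> 'w \<Rightarrow> real) \<Rightarrow> bool" where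
  "simple_integrand M F n p \<xi> \<longleftrightarrow>
     0 \<le> p 0 \<and> (\<forall>i<n. p i \<le> p (Suc i)) \<and>
     (\<forall>i<n. \<xi> i \<in> borel_measurable (F (p i)) \<and> (\<exists>C. \<forall>\<omega>\<in>space M. \<bar>\<xi> i \<omega>\<bar> \<le> C))"

definition simple_process ::
  "nat \<Rightarrow> (nat \<Rightarrow> real) \<Rightarrow> (nat \<Rightarrow> 'w \<Rightarrow> real) \<Rightarrow> real \<Rightarrow> 'w \<Rightarrow> real" where
  "simple_process n p \<xi> s \<omega> = (\<Sum>i<n. \<xi> i \<omega> * indicator {p i<..p (Suc i)} s)"

definition simple_integral ::
  "(real \<Rightarrow> 'w \<Rightarrow> real) \<Rightarrow> nat \<Rightarrow> (nat \<Rightarrow> real) \<Rightarrow> (nat \<Rightarrow> 'w \<Rightarrow> real) \<Rightarrow> real \<Rightarrow> 'w \<Rightarrow> real" where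
  "simple_integral B n p \<xi> t \<omega> = (\<Sum>i<n. \<xi> i \<omega> * (B (min (p (Suc i)) t) \<omega> - B (min (p i) t) \<omega>))"

text \<open>\<open>X\<close> is a version of the Ito integral of \<open>\<Phi>\<close> with respect to \<open>B\<close> over \<open>[0, t]\<close>.\<close>

definition ito_integral ::
  "'w measure \<Rightarrow> (real \<Rightarrow> 'w measure) \<Rightarrow> (real \<Rightarrow> 'w \<Rightarrow> real) \<Rightarrow> (real \<Rightarrow> 'w \<Rightarrow> real) \<Rightarrow>
   real \<Rightarrow> ('w \<Rightarrow> real) \<Rightarrow> bool" where
  "ito_integral M F B \<Phi> t X \<longleftrightarrow>
     X \<in> borel_measurable M \<and>
     (\<lambda>(s, \<omega>). indicator {0..t} s * \<Phi> s \<omega>) \<in> borel_measurable (lborel \<Otimes>\<^sub>M M) \<and>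
     (\<exists>n p \<xi>. (\<forall>m. simple_integrand M F (n m) (p m) (\<xi> m)) \<and>
        (\<lambda>m. \<integral>\<^sup>+\<omega>. (\<integral>\<^sup>+s\<in>{0..t}. ennreal ((simple_process (n m) (p m) (\<xi> m) s \<omega> - \<Phi> s \<omega>)\<^sup>2)
               \<partial>lborel) \<partial>M) \<longlonglongrightarrow> 0 \<and>
        (\<lambda>m. \<integral>\<^sup>+\<omega>. ennreal ((simple_integral B (n m) (p m) (\<xi> m) t \<omega> - X \<omega>)\<^sup>2) \<partial>M) \<longlonglongrightarrow> 0)"

text \<open>Riemann-Stieltjes integral of \<open>f\<close> against \<open>g\<close> over \<open>[u, v]\<close>, as the limit of tagged sums when
  the mesh tends to zero; for Hoelder functions with exponents summing to more than one it exists
  and is the Young integral.\<close>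

definition has_RS_integral ::
  "(real \<Rightarrow> real) \<Rightarrow> (real \<Rightarrow> real) \<Rightarrow> real \<Rightarrow> real \<Rightarrow> real \<Rightarrow> bool" where
  "has_RS_integral f g u v I \<longleftrightarrow>
     (\<forall>\<epsilon>>0. \<exists>\<delta>>0. \<forall>p. p tagged_division_of {u..v} \<and> (\<forall>(x, K)\<in>p. Sup K - Inf K < \<delta>) \<longrightarrow>
        \<bar>(\<Sum>(x, K)\<in>p. f x * (g (Sup K) - g (Inf K))) - I\<bar> < \<epsilon>)"

text \<open>\<open>N\<close> is a continuous version of \<open>\<integral>\<^sub>0\<^sup>t a dB + \<integral>\<^sub>0\<^sup>t b dX\<close>; the second integral is pathwise.\<close>

definition noise_process ::
  "'w measure \<Rightarrow> (real \<Rightarrow> 'w measure) \<Rightarrow> (real \<Rightarrow> 'w \<Rightarrow> real) \<Rightarrow> (real \<Rightarrow> 'w \<Rightarrow> real) \<Rightarrow>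
   (real \<Rightarrow> real) \<Rightarrow> (real \<Rightarrow> real) \<Rightarrow> (real \<Rightarrow> 'w \<Rightarrow> real) \<Rightarrow> bool" where
  "noise_process M F B X a b N \<longleftrightarrow>
     (\<forall>t\<ge>0. N t \<in> borel_measurable M) \<and>
     (\<forall>\<omega>\<in>space M. continuous_on {0..} (\<lambda>t. N t \<omega>)) \<and>
     (\<exists>I J. (\<forall>t\<ge>0. ito_integral M F B (\<lambda>s \<omega>. a s) t (I t)) \<and>
        (AE \<omega> in M. \<forall>t\<ge>0. has_RS_integral b (\<lambda>s. X s \<omega>) 0 t (J t \<omega>)) \<and>
        (\<forall>t\<ge>0. AE \<omega> in M. N t \<omega> = I t \<omega> + J t \<omega>))"

definition volterra_const :: "real \<Rightarrow> real" where
  "volterra_const H = sqrt (H * (2 * H - 1) / Beta (2 - 2 * H) (H - 1 / 2))"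

definition volterra_kernel :: "real \<Rightarrow> real \<Rightarrow> real \<Rightarrow> real" where
  "volterra_kernel H t s =
     (if s < t then volterra_const H * s powr (1 / 2 - H) *
        (LBINT \<sigma>:{s..t}. (\<sigma> - s) powr (H - 3 / 2) * \<sigma> powr (H - 1 / 2)) else 0)"

end

theory Submission
  imports Defs
begin

text \<open>Write \<open>G(t) = \<integral>\<^sub>0\<^sup>t exp (h(s) + 3 N\<^sub>s) ds\<close> with \<open>h(s) = -3 (\<eta>1 \<gamma> s - \<mu>1 K(s) - A(s))\<close>. The function
  \<open>G\<close> is nondecreasing and continuous, so \<open>\<tau> \<le> T\<close> forces \<open>G(T) \<ge> c\<close>, while \<open>\<nu>(T)\<close> is the expectation
  of \<open>G(T)\<close>. The claim is therefore a concentration inequality for an exponential functional of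
  the noise. It rests on one property of each single variable \<open>N\<^sub>s\<close>, namely that it is sub-Gaussian:
  \<open>E exp (\<theta> N\<^sub>s) \<le> exp (\<theta>\<^sup>2 v / 2)\<close> for all real \<open>\<theta>\<close>.

  \<^bold>\<open>From sub-Gaussian marginals to the tail\<close> (\<open>exp_average_tail\<close>). Put \<open>Y\<^sub>s = 3 N\<^sub>s\<close>, let \<open>V\<close> be a
  common variance proxy of the \<open>Y\<^sub>s\<close>, and let \<open>L = ln (c / \<nu>(T)) > 0\<close>. If \<open>L \<le> V\<close>, Markov's inequality
  gives the bound \<open>exp (-L)\<close>, which is at most \<open>exp (- L\<^sup>2 / (2 V))\<close>. If \<open>L > V\<close>, put \<open>p = L / V > 1\<close>.
  Jensen's inequality for the weighted average of \<open>exp Y\<^sub>s\<close> in the time variable turns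
  \<open>G(T) \<ge> c\<close> into a lower bound on \<open>\<integral> e\<^sup>h exp (p Y\<^sub>s) ds\<close>, whose expectation is controlled by
  \<open>exp (p\<^sup>2 V / 2)\<close>. Markov's inequality then gives \<open>exp (- p L + p\<^sup>2 V / 2) = exp (- L\<^sup>2 / (2 V))\<close>. Since a
  sub-Gaussian variable is centred, \<open>E exp Y\<^sub>s \<ge> 1\<close>, so that the total weight \<open>\<integral> e\<^sup>h ds\<close> is at most
  \<open>\<nu>(T)\<close>.

  \<^bold>\<open>The Ito integral\<close> (\<open>ito_integral_sub_gaussian\<close>). For a simple integrand the exponential
  \<open>exp (\<theta> X - \<theta>\<^sup>2 Q / 2)\<close>, with \<open>X\<close> the stochastic integral and \<open>Q\<close> the integral of the squared
  integrand, has expectation one. Along an almost surely convergent subsequence of the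
  approximations \<open>Q\<close> tends to the deterministic \<open>\<integral> a\<^sup>2\<close>, and Fatou's lemma gives the variance proxy
  \<open>\<integral> a\<^sup>2\<close>.

  \<^bold>\<open>The Young integral\<close> (\<open>RS_integral_fbm_sub_gaussian\<close>). The pathwise integral is an almost sure
  limit of Riemann-Stieltjes sums with freely chosen tags, and each sum is a centred Gaussian. On
  each interval a tag is taken at which \<open>b\<^sup>2\<close> does not exceed its mean. The increments of the
  fractional Brownian motion are nonnegatively correlated for \<open>H \<ge> 1/2\<close>, and every row of their
  covariance matrix sums to at most \<open>2 H t\<^sup>2\<^sup>H\<^sup>-\<^sup>1\<close> times the mesh. A Schur test bounds the variances
  of the sums by \<open>2 H t\<^sup>2\<^sup>H\<^sup>-\<^sup>1 \<integral> b\<^sup>2\<close>.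

  The variance proxy of a sum of two sub-Gaussian variables is at most twice the sum of the two
  proxies, by the Cauchy-Schwarz inequality. The factor \<open>3\<close> in the exponent contributes
  \<open>3\<^sup>2 = 9\<close>, and \<open>9 \<cdot> 2 (\<integral> a\<^sup>2 + 2 H T\<^sup>2\<^sup>H\<^sup>-\<^sup>1 \<integral> b\<^sup>2)\<close> is exactly \<open>M(T)\<close>.\<close>

section \<open>Sub-Gaussian random variables\<close>

text \<open>Stating the bound with the nonnegative integral makes integrability of the exponentials part of
  the property, and lets it pass to limits by Fatou's lemma.\<close>

definition sub_gaussian :: "'w measure \<Rightarrow> ('w \<Rightarrow> real) \<Rightarrow> real \<Rightarrow> bool" where
  "sub_gaussian M X v \<longleftrightarrow> X \<in> borel_measurable M \<and>
     (\<forall>\<theta>. (\<integral>\<^sup>+\<omega>. ennreal (exp (\<theta> * X \<omega>)) \<partial>M) \<le> ennreal (exp (\<theta>\<^sup>2 * v / 2)))"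

lemma sub_gaussianD:
  assumes "sub_gaussian M X v"
  shows sub_gaussian_measurable: "X \<in> borel_measurable M"
    and sub_gaussian_mgf: "(\<integral>\<^sup>+\<omega>. ennreal (exp (\<theta> * X \<omega>)) \<partial>M) \<le> ennreal (exp (\<theta>\<^sup>2 * v / 2))"
  using assms unfolding sub_gaussian_def by auto

lemma sub_gaussian_mono:
  assumes "sub_gaussian M X v" "v \<le> w"
  shows "sub_gaussian M X w"
proof -
  have "exp (\<theta>\<^sup>2 * v / 2) \<le> exp (\<theta>\<^sup>2 * w / 2)" for \<theta> :: real
    using assms(2) by (simp add: mult_left_mono)
  then show ?thesis
    using assms(1) unfolding sub_gaussian_def by (meson ennreal_leI order_trans)
qed

lemma sub_gaussian_scale:
  assumes "sub_gaussian M X v"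
  shows "sub_gaussian M (\<lambda>\<omega>. r * X \<omega>) (r\<^sup>2 * v)"
proof -
  have [measurable]: "X \<in> borel_measurable M" by (rule sub_gaussian_measurable[OF assms])
  show ?thesis
    unfolding sub_gaussian_def
  proof (intro conjI allI)
    fix \<theta>
    show "(\<integral>\<^sup>+\<omega>. ennreal (exp (\<theta> * (r * X \<omega>))) \<partial>M) \<le> ennreal (exp (\<theta>\<^sup>2 * (r\<^sup>2 * v) / 2))"
      using sub_gaussian_mgf[OF assms, of "\<theta> * r"] by (simp add: power_mult_distrib mult.assoc)
  qed measurable
qed

text \<open>This is the Cauchy-Schwarz inequality for \<open>exp (\<theta> X)\<close> and \<open>exp (\<theta> Y)\<close>, in the form of Young's
  inequality with a weight \<open>exp \<alpha>\<close>. The choice of \<open>\<alpha>\<close> makes the two resulting terms equal.\<close>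

lemma sub_gaussian_add:
  assumes X: "sub_gaussian M X v" and Y: "sub_gaussian M Y w"
  shows "sub_gaussian M (\<lambda>\<omega>. X \<omega> + Y \<omega>) (2 * (v + w))"
proof -
  have [measurable]: "X \<in> borel_measurable M" "Y \<in> borel_measurable M"
    using X Y by (auto dest: sub_gaussian_measurable)
  show ?thesis
    unfolding sub_gaussian_def
  proof (intro conjI allI)
    fix \<theta> :: real
    define \<alpha> where "\<alpha> = \<theta>\<^sup>2 * (v - w)"
    have young: "exp (\<theta> * (x + y)) \<le> exp (- \<alpha>) / 2 * exp (2 * \<theta> * x) + exp \<alpha> / 2 * exp (2 * \<theta> * y)"
      for x y :: real
    proof -
      have "2 * (exp (\<theta> * x - \<alpha> / 2) * exp (\<theta> * y + \<alpha> / 2))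
          \<le> (exp (\<theta> * x - \<alpha> / 2))\<^sup>2 + (exp (\<theta> * y + \<alpha> / 2))\<^sup>2"
        using sum_squares_bound by (metis mult.assoc)
      moreover have "exp (\<theta> * x - \<alpha> / 2) * exp (\<theta> * y + \<alpha> / 2) = exp (\<theta> * (x + y))"
        by (simp add: exp_add[symmetric] algebra_simps)
      moreover have "(exp (\<theta> * x - \<alpha> / 2))\<^sup>2 = exp (- \<alpha>) * exp (2 * \<theta> * x)"
        "(exp (\<theta> * y + \<alpha> / 2))\<^sup>2 = exp \<alpha> * exp (2 * \<theta> * y)"
        by (simp_all add: power2_eq_square exp_add[symmetric] algebra_simps)
      ultimately show ?thesis by simp
    qed
    have "(\<integral>\<^sup>+\<omega>. ennreal (exp (\<theta> * (X \<omega> + Y \<omega>))) \<partial>M)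
        \<le> (\<integral>\<^sup>+\<omega>. ennreal (exp (- \<alpha>) / 2) * ennreal (exp ((2 * \<theta>) * X \<omega>))
              + ennreal (exp \<alpha> / 2) * ennreal (exp ((2 * \<theta>) * Y \<omega>)) \<partial>M)"
    proof (rule nn_integral_mono)
      fix \<omega>
      show "ennreal (exp (\<theta> * (X \<omega> + Y \<omega>))) \<le> ennreal (exp (- \<alpha>) / 2) * ennreal (exp ((2 * \<theta>) * X \<omega>))
              + ennreal (exp \<alpha> / 2) * ennreal (exp ((2 * \<theta>) * Y \<omega>))"
        by (rule order.trans[OF ennreal_leI[OF young[of "X \<omega>" "Y \<omega>"]]])
           (simp only: ennreal_plus ennreal_mult exp_ge_zero divide_nonneg_pos zero_less_numeral mult_nonneg_nonneg order.refl)
    qed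
    also have "\<dots> = ennreal (exp (- \<alpha>) / 2) * (\<integral>\<^sup>+\<omega>. ennreal (exp ((2 * \<theta>) * X \<omega>)) \<partial>M)
              + ennreal (exp \<alpha> / 2) * (\<integral>\<^sup>+\<omega>. ennreal (exp ((2 * \<theta>) * Y \<omega>)) \<partial>M)"
      by (subst nn_integral_add) (auto simp: nn_integral_cmult)
    also have "\<dots> \<le> ennreal (exp (- \<alpha>) / 2) * ennreal (exp ((2 * \<theta>)\<^sup>2 * v / 2))
              + ennreal (exp \<alpha> / 2) * ennreal (exp ((2 * \<theta>)\<^sup>2 * w / 2))"
      by (intro add_mono mult_left_mono sub_gaussian_mgf X Y) auto
    also have "\<dots> = ennreal (exp (\<theta>\<^sup>2 * (2 * (v + w)) / 2))"
    proof -
      have "exp (- \<alpha>) * exp ((2 * \<theta>)\<^sup>2 * v / 2) = exp (\<theta>\<^sup>2 * (2 * (v + w)) / 2)"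
           "exp \<alpha> * exp ((2 * \<theta>)\<^sup>2 * w / 2) = exp (\<theta>\<^sup>2 * (2 * (v + w)) / 2)"
        by (simp_all add: \<alpha>_def exp_add[symmetric] power2_eq_square algebra_simps)
      then show ?thesis
        by (simp add: ennreal_mult[symmetric] ennreal_plus[symmetric] del: ennreal_plus)
    qed
    finally show "(\<integral>\<^sup>+\<omega>. ennreal (exp (\<theta> * (X \<omega> + Y \<omega>))) \<partial>M)
        \<le> ennreal (exp (\<theta>\<^sup>2 * (2 * (v + w)) / 2))" .
  qed measurable
qed

text \<open>Fatou's lemma. The random variances \<open>Q\<close> accommodate stochastic integrals of random simple
  integrands, whose quadratic variation becomes deterministic only in the limit.\<close>

lemma sub_gaussian_limit:
  assumes X: "X \<in> borel_measurable M" "\<And>n. Xn n \<in> borel_measurable M"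
    and Q: "\<And>n. Q n \<in> borel_measurable M"
    and mgf: "\<And>n \<theta>. (\<integral>\<^sup>+\<omega>. ennreal (exp (\<theta> * Xn n \<omega> - \<theta>\<^sup>2 * Q n \<omega> / 2)) \<partial>M) \<le> 1"
    and Xlim: "AE \<omega> in M. (\<lambda>n. Xn n \<omega>) \<longlonglongrightarrow> X \<omega>"
    and Qlim: "AE \<omega> in M. (\<lambda>n. Q n \<omega>) \<longlonglongrightarrow> v"
  shows "sub_gaussian M X v"
  unfolding sub_gaussian_def
proof (intro conjI allI)
  show "X \<in> borel_measurable M" by fact
  note [measurable] = X Q
  fix \<theta> :: real
  have "(\<integral>\<^sup>+\<omega>. ennreal (exp (\<theta> * X \<omega> - \<theta>\<^sup>2 * v / 2)) \<partial>M)
      = (\<integral>\<^sup>+\<omega>. liminf (\<lambda>n. ennreal (exp (\<theta> * Xn n \<omega> - \<theta>\<^sup>2 * Q n \<omega> / 2))) \<partial>M)"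
  proof (rule nn_integral_cong_AE)
    show "AE \<omega> in M. ennreal (exp (\<theta> * X \<omega> - \<theta>\<^sup>2 * v / 2))
        = liminf (\<lambda>n. ennreal (exp (\<theta> * Xn n \<omega> - \<theta>\<^sup>2 * Q n \<omega> / 2)))"
      using Xlim Qlim
    proof eventually_elim
      case (elim \<omega>)
      have "(\<lambda>n. ennreal (exp (\<theta> * Xn n \<omega> - \<theta>\<^sup>2 * Q n \<omega> / 2)))
          \<longlonglongrightarrow> ennreal (exp (\<theta> * X \<omega> - \<theta>\<^sup>2 * v / 2))"
        by (intro tendsto_ennrealI tendsto_intros elim) simp
      then show ?case by (rule lim_imp_Liminf[OF trivial_limit_sequentially, symmetric])
    qed
  qed
  also have "\<dots> \<le> liminf (\<lambda>n. \<integral>\<^sup>+\<omega>. ennreal (exp (\<theta> * Xn n \<omega> - \<theta>\<^sup>2 * Q n \<omega> / 2)) \<partial>M)"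
    by (rule nn_integral_liminf) measurable
  also have "\<dots> \<le> 1"
    by (rule Liminf_le) (use mgf in auto)
  finally have le: "(\<integral>\<^sup>+\<omega>. ennreal (exp (\<theta> * X \<omega> - \<theta>\<^sup>2 * v / 2)) \<partial>M) \<le> 1" .
  have "(\<integral>\<^sup>+\<omega>. ennreal (exp (\<theta> * X \<omega>)) \<partial>M)
      = (\<integral>\<^sup>+\<omega>. ennreal (exp (\<theta>\<^sup>2 * v / 2)) * ennreal (exp (\<theta> * X \<omega> - \<theta>\<^sup>2 * v / 2)) \<partial>M)"
    by (intro nn_integral_cong) (simp add: ennreal_mult[symmetric] exp_add[symmetric])
  also have "\<dots> \<le> ennreal (exp (\<theta>\<^sup>2 * v / 2)) * 1"
    by (subst nn_integral_cmult, measurable) (intro mult_left_mono le, simp)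
  finally show "(\<integral>\<^sup>+\<omega>. ennreal (exp (\<theta> * X \<omega>)) \<partial>M) \<le> ennreal (exp (\<theta>\<^sup>2 * v / 2))" by simp
qed

lemma sub_gaussian_normalized_mgf:
  assumes X: "sub_gaussian M X v"
  shows "(\<integral>\<^sup>+\<omega>. ennreal (exp (\<theta> * X \<omega> - \<theta>\<^sup>2 * v / 2)) \<partial>M) \<le> 1"
proof -
  have [measurable]: "X \<in> borel_measurable M" using X by (rule sub_gaussian_measurable)
  let ?q = "\<theta>\<^sup>2 * v / 2"
  have "(\<integral>\<^sup>+\<omega>. ennreal (exp (\<theta> * X \<omega> - ?q)) \<partial>M) = (\<integral>\<^sup>+\<omega>. ennreal (exp (- ?q)) * ennreal (exp (\<theta> * X \<omega>)) \<partial>M)"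
    by (intro nn_integral_cong) (simp add: ennreal_mult[symmetric] exp_add[symmetric])
  also have "\<dots> = ennreal (exp (- ?q)) * (\<integral>\<^sup>+\<omega>. ennreal (exp (\<theta> * X \<omega>)) \<partial>M)"
    by (rule nn_integral_cmult) measurable
  also have "\<dots> \<le> ennreal (exp (- ?q)) * ennreal (exp ?q)"
    by (intro mult_left_mono sub_gaussian_mgf[OF X]) simp
  also have "\<dots> = 1"
    by (simp add: ennreal_mult[symmetric] exp_add[symmetric])
  finally show ?thesis .
qed

text \<open>For the Ito integral the variance proxy is first obtained with a loss \<open>\<epsilon>\<close>; this removes it.\<close>

lemma sub_gaussian_right_limit:
  assumes "\<And>\<epsilon>. 0 < \<epsilon> \<Longrightarrow> sub_gaussian M X (v + \<epsilon> * w)"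
  shows "sub_gaussian M X v"
proof -
  have *: "sub_gaussian M X (v + 1 / real (Suc n) * w)" for n
    by (intro assms) simp
  have [measurable]: "X \<in> borel_measurable M" using *[of 0] by (rule sub_gaussian_measurable)
  show ?thesis
  proof (rule sub_gaussian_limit[where Xn = "\<lambda>n. X" and Q = "\<lambda>n \<omega>. v + 1 / real (Suc n) * w"])
    show "(\<integral>\<^sup>+\<omega>. ennreal (exp (\<theta> * X \<omega> - \<theta>\<^sup>2 * (v + 1 / real (Suc n) * w) / 2)) \<partial>M) \<le> 1" for n \<theta>
      by (rule sub_gaussian_normalized_mgf[OF *])
  next
    have "(\<lambda>n. v + 1 / real (Suc n) * w) \<longlonglongrightarrow> v + 0 * w"
      using LIMSEQ_inverse_real_of_nat by (intro tendsto_intros) (simp add: field_simps)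
    then show "AE \<omega> in M. (\<lambda>n. v + 1 / real (Suc n) * w) \<longlonglongrightarrow> v" by simp
  qed auto
qed

text \<open>The two bounds \<open>1 + \<theta> E X \<le> E exp (\<theta> X) \<le> exp (\<theta>\<^sup>2 v / 2)\<close> agree at \<open>\<theta> = 0\<close>, so their
  derivatives agree there and \<open>E X = 0\<close>. Jensen's inequality then gives the lower bound.\<close>

lemma (in prob_space) sub_gaussian_one_le_mgf:
  assumes X: "sub_gaussian M X v"
  shows "integrable M (\<lambda>\<omega>. exp (\<theta> * X \<omega>))" and "1 \<le> expectation (\<lambda>\<omega>. exp (\<theta> * X \<omega>))"
    and "expectation (\<lambda>\<omega>. exp (\<theta> * X \<omega>)) \<le> exp (\<theta>\<^sup>2 * v / 2)"
proof -
  have [measurable]: "X \<in> borel_measurable M" using X by (rule sub_gaussian_measurable)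
  have int: "integrable M (\<lambda>\<omega>. exp (\<theta> * X \<omega>))" for \<theta>
    by (rule integrableI_bounded)
       (use sub_gaussian_mgf[OF X, of \<theta>] in \<open>auto intro: le_less_trans\<close>)
  have bound: "expectation (\<lambda>\<omega>. exp (\<theta> * X \<omega>)) \<le> exp (\<theta>\<^sup>2 * v / 2)" for \<theta>
    using sub_gaussian_mgf[OF X, of \<theta>]
    by (subst (asm) nn_integral_eq_integral[OF int]) auto
  have intX: "integrable M X"
  proof (rule Bochner_Integration.integrable_bound)
    show "integrable M (\<lambda>\<omega>. exp (1 * X \<omega>) + exp (- 1 * X \<omega>))"
      by (intro Bochner_Integration.integrable_add int)
    show "AE \<omega> in M. norm (X \<omega>) \<le> norm (exp (1 * X \<omega>) + exp (- 1 * X \<omega>))"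
    proof (rule AE_I2)
      fix \<omega>
      have "\<bar>X \<omega>\<bar> \<le> exp (X \<omega>) + exp (- X \<omega>)"
        using exp_ge_add_one_self[of "X \<omega>"] exp_ge_add_one_self[of "- X \<omega>"]
          exp_gt_zero[of "X \<omega>"] exp_gt_zero[of "- X \<omega>"] by linarith
      then show "norm (X \<omega>) \<le> norm (exp (1 * X \<omega>) + exp (- 1 * X \<omega>))" by simp
    qed
  qed measurable
  have jensen: "1 + \<theta> * expectation X \<le> expectation (\<lambda>\<omega>. exp (\<theta> * X \<omega>))" for \<theta>
  proof -
    have "expectation (\<lambda>\<omega>. 1 + \<theta> * X \<omega>) \<le> expectation (\<lambda>\<omega>. exp (\<theta> * X \<omega>))"
      by (intro integral_mono int Bochner_Integration.integrable_add integrable_mult_right intX)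
         (simp_all add: exp_ge_add_one_self)
    then show ?thesis using intX by (simp add: prob_space)
  qed
  have "- expectation X = 0"
  proof (rule DERIV_local_min)
    let ?f = "\<lambda>\<theta>::real. exp (\<theta>\<^sup>2 * v / 2) - 1 - \<theta> * expectation X"
    show "DERIV ?f 0 :> - expectation X"
      by (auto intro!: derivative_eq_intros)
    show "0 < (1::real)" by simp
    show "\<forall>y. \<bar>0 - y\<bar> < 1 \<longrightarrow> ?f 0 \<le> ?f y"
    proof (intro allI impI)
      fix y show "?f 0 \<le> ?f y" using jensen[of y] bound[of y] by simp
    qed
  qed
  then have "expectation X = 0" by simp
  then show "1 \<le> expectation (\<lambda>\<omega>. exp (\<theta> * X \<omega>))" using jensen[of \<theta>] by simp
  show "integrable M (\<lambda>\<omega>. exp (\<theta> * X \<omega>))" "expectation (\<lambda>\<omega>. exp (\<theta> * X \<omega>)) \<le> exp (\<theta>\<^sup>2 * v / 2)"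
    by (fact int bound)+
qed

text \<open>Completing the square shifts the mean of the density from \<open>0\<close> to \<open>\<theta> d\<close>.\<close>

lemma nn_integral_normal_density_exp:
  assumes "0 < d"
  shows "(\<integral>\<^sup>+z. ennreal (normal_density 0 (sqrt d) z) * ennreal (exp (\<theta> * z)) \<partial>lborel)
    = ennreal (exp (\<theta>\<^sup>2 * d / 2))"
proof -
  have "normal_density 0 (sqrt d) z * exp (\<theta> * z)
      = exp (\<theta>\<^sup>2 * d / 2) * normal_density (\<theta> * d) (sqrt d) z" for z
  proof -
    have "- z\<^sup>2 / (2 * d) + \<theta> * z = \<theta>\<^sup>2 * d / 2 - (z - \<theta> * d)\<^sup>2 / (2 * d)"
      using assms by (simp add: field_simps power2_eq_square)
    then have "exp (- z\<^sup>2 / (2 * d)) * exp (\<theta> * z) = exp (\<theta>\<^sup>2 * d / 2) * exp (- (z - \<theta> * d)\<^sup>2 / (2 * d))"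
      by (simp add: exp_add[symmetric])
    then show ?thesis using assms by (simp add: normal_density_def)
  qed
  then have "(\<integral>\<^sup>+z. ennreal (normal_density 0 (sqrt d) z) * ennreal (exp (\<theta> * z)) \<partial>lborel)
      = (\<integral>\<^sup>+z. ennreal (exp (\<theta>\<^sup>2 * d / 2)) * ennreal (normal_density (\<theta> * d) (sqrt d) z) \<partial>lborel)"
    by (simp add: ennreal_mult[symmetric])
  also have "\<dots> = ennreal (exp (\<theta>\<^sup>2 * d / 2)) * (\<integral>\<^sup>+z. ennreal (normal_density (\<theta> * d) (sqrt d) z) \<partial>lborel)"
    by (rule nn_integral_cmult) measurable
  also have "(\<integral>\<^sup>+z. ennreal (normal_density (\<theta> * d) (sqrt d) z) \<partial>lborel) = 1"
    using assms by (subst nn_integral_eq_integral) auto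
  finally show ?thesis by simp
qed

lemma (in prob_space) centred_gaussian_sub_gaussian:
  assumes "centred_gaussian M X v"
  shows "sub_gaussian M X v"
proof -
  have [measurable]: "X \<in> borel_measurable M" using assms by (simp add: centred_gaussian_def)
  have "(\<integral>\<^sup>+\<omega>. ennreal (exp (\<theta> * X \<omega>)) \<partial>M) = ennreal (exp (\<theta>\<^sup>2 * v / 2))" for \<theta>
  proof (cases "0 < v \<and> distributed M lborel X (normal_density 0 (sqrt v))")
    case True
    then show ?thesis
      using nn_integral_normal_density_exp[of v \<theta>]
      by (subst distributed_nn_integral[symmetric]) auto
  next
    case False
    then have "v = 0" "AE \<omega> in M. X \<omega> = 0" using assms by (auto simp: centred_gaussian_def)
    then have "(\<integral>\<^sup>+\<omega>. ennreal (exp (\<theta> * X \<omega>)) \<partial>M) = (\<integral>\<^sup>+\<omega>. 1 \<partial>M)"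
      by (intro nn_integral_cong_AE) auto
    then show ?thesis using \<open>v = 0\<close> by (simp add: emeasure_space_1)
  qed
  then show ?thesis by (simp add: sub_gaussian_def)
qed

section \<open>The Ito integral of a deterministic function\<close>

lemma filtered_borel_measurable:
  assumes "filtered_prob_space M F" "f \<in> measurable (F s) N"
  shows "f \<in> measurable M N"
  using assms unfolding filtered_prob_space_def filtration_def
  by (auto simp: measurable_def subset_iff)

text \<open>The increment is independent of the past \<open>F s\<close>. Hence the pair of the outcome, seen in \<open>F s\<close>, and
  the increment has a product law, and one may integrate out the increment with \<open>Y\<close> and \<open>\<xi>\<close> frozen.
  The inner integral is the exponential moment of a centred normal variable, which cancels the
  compensator.\<close>

lemma brownian_exponential_step:
  assumes fil: "filtered_prob_space M F" and BM: "brownian_motion M F B"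
    and su: "0 \<le> s" "s < u"
    and Y: "Y \<in> borel_measurable (F s)" and \<xi>: "\<xi> \<in> borel_measurable (F s)"
  shows "(\<integral>\<^sup>+\<omega>. Y \<omega> * ennreal (exp (\<theta> * (\<xi> \<omega> * (B u \<omega> - B s \<omega>)) - \<theta>\<^sup>2 * ((\<xi> \<omega>)\<^sup>2 * (u - s)) / 2)) \<partial>M)
    = (\<integral>\<^sup>+\<omega>. Y \<omega> \<partial>M)"
proof -
  interpret prob_space M using fil by (simp add: filtered_prob_space_def)
  let ?D = "\<lambda>\<omega>. B u \<omega> - B s \<omega>"
  have spF: "space (F s) = space M" and setsF: "sets (F s) \<subseteq> sets M"
    using fil by (auto simp: filtered_prob_space_def filtration.space_F)
  have dist: "distributed M lborel ?D (normal_density 0 (sqrt (u - s)))"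
    and ind: "indep_set (sets (F s)) (sets (vimage_algebra (space M) ?D borel))"
    using BM su by (auto simp: brownian_motion_def)
  have D [measurable]: "?D \<in> borel_measurable M" using dist by (simp add: distributed_def)
  have id [measurable]: "(\<lambda>\<omega>. \<omega>) \<in> measurable M (F s)"
    using setsF spF by (intro measurableI) (auto dest: sets.sets_into_space)
  interpret D: prob_space "distr M borel ?D" by (rule prob_space_distr) measurable
  interpret I: prob_space "distr M (F s) (\<lambda>\<omega>. \<omega>)" by (rule prob_space_distr) measurable
  have joint: "distr M (F s) (\<lambda>\<omega>. \<omega>) \<Otimes>\<^sub>M distr M borel ?D = distr M (F s \<Otimes>\<^sub>M borel) (\<lambda>\<omega>. (\<omega>, ?D \<omega>))"
  proof (rule pair_measure_eqI)
    show "sigma_finite_measure (distr M (F s) (\<lambda>\<omega>. \<omega>))" "sigma_finite_measure (distr M borel ?D)"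
      by unfold_locales
    fix A C
    assume "A \<in> sets (distr M (F s) (\<lambda>\<omega>. \<omega>))" and "C \<in> sets (distr M borel ?D)"
    then have A: "A \<in> sets (F s)" and C: "C \<in> sets borel" by auto
    have A': "A \<subseteq> space M" using sets.sets_into_space[OF A] spF by simp
    have "?D -` C \<inter> space M \<in> sets (vimage_algebra (space M) ?D borel)"
      using C by (rule in_vimage_algebra)
    from indep_setD[OF ind A this]
    have "emeasure M A * emeasure M (?D -` C \<inter> space M) = emeasure M (A \<inter> (?D -` C \<inter> space M))"
      by (simp add: emeasure_eq_measure ennreal_mult)
    moreover have "A \<inter> (?D -` C \<inter> space M) = (\<lambda>\<omega>. (\<omega>, ?D \<omega>)) -` (A \<times> C) \<inter> space M"
      by auto
    moreover have "(\<lambda>\<omega>. \<omega>) -` A \<inter> space M = A" using A' by auto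
    moreover have "A \<times> C \<in> sets (F s \<Otimes>\<^sub>M borel)" using A C by simp
    ultimately show "emeasure (distr M (F s) (\<lambda>\<omega>. \<omega>)) A * emeasure (distr M borel ?D) C
        = emeasure (distr M (F s \<Otimes>\<^sub>M borel) (\<lambda>\<omega>. (\<omega>, ?D \<omega>))) (A \<times> C)"
      using A C by (simp add: emeasure_distr)
  qed simp
  define g where "g = (\<lambda>(\<omega>, z). Y \<omega> * ennreal (exp (\<theta> * (\<xi> \<omega> * z) - \<theta>\<^sup>2 * ((\<xi> \<omega>)\<^sup>2 * (u - s)) / 2)))"
  note [measurable] = Y \<xi>
  have g [measurable]: "g \<in> borel_measurable (F s \<Otimes>\<^sub>M borel)" unfolding g_def by measurable
  have inner: "(\<integral>\<^sup>+z. g (\<omega>, z) \<partial>distr M borel ?D) = Y \<omega>" if \<omega>: "\<omega> \<in> space (F s)" for \<omega>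
  proof -
    let ?q = "\<theta>\<^sup>2 * ((\<xi> \<omega>)\<^sup>2 * (u - s)) / 2"
    have "(\<integral>\<^sup>+z. g (\<omega>, z) \<partial>distr M borel ?D)
        = (\<integral>\<^sup>+z. (Y \<omega> * ennreal (exp (- ?q))) * ennreal (exp ((\<theta> * \<xi> \<omega>) * z)) \<partial>distr M borel ?D)"
      by (intro nn_integral_cong)
         (simp add: g_def mult.assoc ennreal_mult[symmetric] exp_add[symmetric])
    also have "\<dots> = (Y \<omega> * ennreal (exp (- ?q))) * (\<integral>\<^sup>+z. ennreal (exp ((\<theta> * \<xi> \<omega>) * z)) \<partial>distr M borel ?D)"
      by (rule nn_integral_cmult) simp
    also have "(\<integral>\<^sup>+z. ennreal (exp ((\<theta> * \<xi> \<omega>) * z)) \<partial>distr M borel ?D)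
        = (\<integral>\<^sup>+\<omega>'. ennreal (exp ((\<theta> * \<xi> \<omega>) * ?D \<omega>')) \<partial>M)"
      by (rule nn_integral_distr) measurable
    also have "\<dots> = (\<integral>\<^sup>+z. ennreal (normal_density 0 (sqrt (u - s)) z) * ennreal (exp ((\<theta> * \<xi> \<omega>) * z)) \<partial>lborel)"
      by (rule distributed_nn_integral[OF dist, symmetric]) measurable
    also have "\<dots> = ennreal (exp ((\<theta> * \<xi> \<omega>)\<^sup>2 * (u - s) / 2))"
      using su by (intro nn_integral_normal_density_exp) simp
    also have "(\<theta> * \<xi> \<omega>)\<^sup>2 * (u - s) / 2 = ?q" by (simp add: power_mult_distrib)
    finally show ?thesis by (simp add: mult.assoc ennreal_mult[symmetric] exp_add[symmetric])
  qed
  have "(\<integral>\<^sup>+\<omega>. g (\<omega>, ?D \<omega>) \<partial>M) = (\<integral>\<^sup>+z. g z \<partial>distr M (F s \<Otimes>\<^sub>M borel) (\<lambda>\<omega>. (\<omega>, ?D \<omega>)))"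
    by (rule nn_integral_distr[symmetric]) measurable
  also have "\<dots> = (\<integral>\<^sup>+\<omega>. \<integral>\<^sup>+z. g (\<omega>, z) \<partial>distr M borel ?D \<partial>distr M (F s) (\<lambda>\<omega>. \<omega>))"
    unfolding joint[symmetric] by (rule D.nn_integral_fst[symmetric]) measurable
  also have "\<dots> = (\<integral>\<^sup>+\<omega>. Y \<omega> \<partial>distr M (F s) (\<lambda>\<omega>. \<omega>))"
    by (rule nn_integral_cong) (simp add: inner)
  also have "\<dots> = (\<integral>\<^sup>+\<omega>. Y \<omega> \<partial>M)" using Y by (subst nn_integral_distr[OF id]) simp_all
  finally show ?thesis by (simp add: g_def)
qed

text \<open>The quadratic variation at time \<open>t\<close> of the stochastic integral of a simple integrand.\<close>

definition simple_energy :: "nat \<Rightarrow> (nat \<Rightarrow> real) \<Rightarrow> (nat \<Rightarrow> 'w \<Rightarrow> real) \<Rightarrow> real \<Rightarrow> 'w \<Rightarrow> real" where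
  "simple_energy n p \<xi> t \<omega> = (\<Sum>i<n. (\<xi> i \<omega>)\<^sup>2 * (min (p (Suc i)) t - min (p i) t))"

lemma simple_integrand_mono:
  assumes "simple_integrand M F n p \<xi>" "i \<le> j" "j \<le> n"
  shows "p i \<le> p j"
  using assms(2,3)
proof (induction rule: dec_induct)
  case (step k)
  then have "p k \<le> p (Suc k)" using assms(1) by (simp add: simple_integrand_def)
  with step show ?case by simp
qed simp

text \<open>Induction on the number of intervals, peeling off the last one. Intervals that begin after \<open>t\<close>
  carry the zero increment, and otherwise \<open>min (p k) t = p k\<close>, where \<open>\<xi> k\<close> is known.\<close>

lemma simple_exponential_martingale:
  assumes fil: "filtered_prob_space M F" and BM: "brownian_motion M F B"
    and si: "simple_integrand M F n p \<xi>" and t: "0 \<le> t"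
  shows "(\<integral>\<^sup>+\<omega>. ennreal (exp (\<theta> * simple_integral B n p \<xi> t \<omega> - \<theta>\<^sup>2 * simple_energy n p \<xi> t \<omega> / 2)) \<partial>M) = 1"
proof -
  interpret prob_space M using fil by (simp add: filtered_prob_space_def)
  have mono: "sets (F r) \<subseteq> sets (F s)" if "r \<le> s" for r s
    using fil that by (auto simp: filtered_prob_space_def dest: filtration.sets_F_mono)
  have sp: "space (F r) = space (F s)" for r s
    using fil by (auto simp: filtered_prob_space_def filtration.space_F)
  have lift: "f \<in> borel_measurable (F s)" if "f \<in> borel_measurable (F r)" "r \<le> s" for f :: "'a \<Rightarrow> real" and r s
    using that mono[of r s] sp[of r s] by (auto simp: measurable_def subset_iff)
  have p0: "0 \<le> p i" if "i \<le> n" for i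
    using simple_integrand_mono[OF si, of 0 i] si that by (simp add: simple_integrand_def)
  let ?E = "\<lambda>k \<omega>. exp (\<theta> * simple_integral B k p \<xi> t \<omega> - \<theta>\<^sup>2 * simple_energy k p \<xi> t \<omega> / 2)"
  have meas: "?E k \<in> borel_measurable (F (p k))" if "k \<le> n" for k
  proof -
    have Bm: "B (min (p i) t) \<in> borel_measurable (F (p k))" if "i \<le> k" for i
    proof (rule lift)
      show "B (min (p i) t) \<in> borel_measurable (F (min (p i) t))"
        using BM p0[of i] t that \<open>k \<le> n\<close> by (simp add: brownian_motion_def)
      show "min (p i) t \<le> p k" using simple_integrand_mono[OF si that \<open>k \<le> n\<close>] by simp
    qed
    have \<xi>m: "\<xi> i \<in> borel_measurable (F (p k))" if "i < k" for i
      using si that \<open>k \<le> n\<close> simple_integrand_mono[OF si, of i k]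
      by - (rule lift[of _ "p i"], auto simp: simple_integrand_def)
    show ?thesis
      unfolding simple_integral_def simple_energy_def
      by (rule measurable_compose[OF _ borel_measurable_exp], intro borel_measurable_diff borel_measurable_times borel_measurable_sum
          borel_measurable_power borel_measurable_divide borel_measurable_const Bm \<xi>m) auto
  qed
  have "(\<integral>\<^sup>+\<omega>. ennreal (?E k \<omega>) \<partial>M) = 1" if "k \<le> n" for k
    using that
  proof (induction k)
    case 0
    then show ?case by (simp add: simple_integral_def simple_energy_def emeasure_space_1)
  next
    case (Suc k)
    let ?s = "min (p k) t" and ?u = "min (p (Suc k)) t"
    have split: "?E (Suc k) \<omega> = ?E k \<omega> * exp (\<theta> * (\<xi> k \<omega> * (B ?u \<omega> - B ?s \<omega>)) - \<theta>\<^sup>2 * ((\<xi> k \<omega>)\<^sup>2 * (?u - ?s)) / 2)" for \<omega>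
      by (simp add: simple_integral_def simple_energy_def exp_add[symmetric] distrib_left add_divide_distrib)
    have pk: "p k \<le> p (Suc k)" using si Suc.prems by (simp add: simple_integrand_def)
    show ?case
    proof (cases "?s < ?u")
      case False
      with pk have "?s = ?u" by (simp add: min_def split: if_splits)
      then have "?E (Suc k) \<omega> = ?E k \<omega>" for \<omega> unfolding split by simp
      then show ?thesis using Suc by simp
    next
      case True
      then have s: "?s = p k" by (simp add: min_def split: if_splits)
      have "(\<integral>\<^sup>+\<omega>. ennreal (?E (Suc k) \<omega>) \<partial>M)
          = (\<integral>\<^sup>+\<omega>. ennreal (?E k \<omega>) * ennreal (exp (\<theta> * (\<xi> k \<omega> * (B ?u \<omega> - B (p k) \<omega>)) - \<theta>\<^sup>2 * ((\<xi> k \<omega>)\<^sup>2 * (?u - p k)) / 2)) \<partial>M)"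
        unfolding split s by (simp add: ennreal_mult)
      also have "\<dots> = (\<integral>\<^sup>+\<omega>. ennreal (?E k \<omega>) \<partial>M)"
        using True s p0[of k] Suc.prems meas[of k] si
        by (intro brownian_exponential_step[OF fil BM]) (auto simp: simple_integrand_def)
      finally show ?thesis using Suc by simp
    qed
  qed
  from this[of n] show ?thesis by simp
qed

text \<open>The intervals are disjoint, so squaring the step function squares its values.\<close>

lemma simple_energy_eq_nn_integral:
  assumes si: "simple_integrand M F n p \<xi>" and t: "0 \<le> t"
  shows "(\<integral>\<^sup>+s\<in>{0..t}. ennreal ((simple_process n p \<xi> s \<omega>)\<^sup>2) \<partial>lborel) = ennreal (simple_energy n p \<xi> t \<omega>)"
proof -
  let ?I = "\<lambda>i. {p i<..p (Suc i)}"
  have disj: "?I i \<inter> ?I j = {}" if "i < n" "j < n" "i \<noteq> j" for i j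
    using that simple_integrand_mono[OF si, of "Suc i" j] simple_integrand_mono[OF si, of "Suc j" i]
    by (cases i j rule: linorder_cases) auto
  have sq: "(\<Sum>i<k. \<xi> i \<omega> * indicator (?I i) s)\<^sup>2 = (\<Sum>i<k. (\<xi> i \<omega>)\<^sup>2 * indicator (?I i) s)" if "k \<le> n" for k s
    using that
  proof (induction k)
    case (Suc k)
    have "(\<Sum>i<k. \<xi> i \<omega> * indicator (?I i) s) * indicator (?I k) s = 0"
      unfolding sum_distrib_right
    proof (intro sum.neutral ballI)
      fix i assume "i \<in> {..<k}"
      then have "?I i \<inter> ?I k = {}" using Suc.prems by (intro disj) auto
      then have "s \<notin> ?I i \<or> s \<notin> ?I k" by blast
      then show "\<xi> i \<omega> * indicator (?I i) s * indicator (?I k) s = 0" by (auto simp: indicator_def)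
    qed
    then have "(\<Sum>i<Suc k. \<xi> i \<omega> * indicator (?I i) s)\<^sup>2
        = (\<Sum>i<k. \<xi> i \<omega> * indicator (?I i) s)\<^sup>2 + (\<xi> k \<omega> * indicator (?I k) s)\<^sup>2"
      by (simp add: power2_sum mult.left_commute)
    then show ?case using Suc by (simp add: power_mult_distrib indicator_def)
  qed simp
  have p0: "0 \<le> p i" if "i \<le> n" for i
    using simple_integrand_mono[OF si, of 0 i] si that by (simp add: simple_integrand_def)
  have "(\<integral>\<^sup>+s\<in>{0..t}. ennreal ((simple_process n p \<xi> s \<omega>)\<^sup>2) \<partial>lborel)
      = (\<integral>\<^sup>+s. (\<Sum>i<n. ennreal ((\<xi> i \<omega>)\<^sup>2) * indicator {min (p i) t<..min (p (Suc i)) t} s) \<partial>lborel)"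
  proof (intro nn_integral_cong)
    fix s :: real
    have ind: "indicator (?I i) s * indicator {0..t} s = (indicator {min (p i) t<..min (p (Suc i)) t} s :: real)" if "i < n" for i
      using p0[of i] that by (auto simp: indicator_def)
    have "ennreal ((simple_process n p \<xi> s \<omega>)\<^sup>2) * indicator {0..t} s
        = ennreal ((\<Sum>i<n. (\<xi> i \<omega>)\<^sup>2 * indicator (?I i) s) * indicator {0..t} s)"
      using sq[of n s] by (simp add: simple_process_def indicator_def)
    also have "(\<Sum>i<n. (\<xi> i \<omega>)\<^sup>2 * indicator (?I i) s) * indicator {0..t} s
        = (\<Sum>i<n. (\<xi> i \<omega>)\<^sup>2 * indicator {min (p i) t<..min (p (Suc i)) t} s)"
      unfolding sum_distrib_right by (rule sum.cong) (simp_all add: ind mult.assoc)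
    also have "ennreal \<dots> = (\<Sum>i<n. ennreal ((\<xi> i \<omega>)\<^sup>2) * indicator {min (p i) t<..min (p (Suc i)) t} s)"
      by (subst sum_ennreal[symmetric]) (auto intro!: sum.cong simp: indicator_def)
    finally show "ennreal ((simple_process n p \<xi> s \<omega>)\<^sup>2) * indicator {0..t} s
        = (\<Sum>i<n. ennreal ((\<xi> i \<omega>)\<^sup>2) * indicator {min (p i) t<..min (p (Suc i)) t} s)" .
  qed
  also have "\<dots> = (\<Sum>i<n. ennreal ((\<xi> i \<omega>)\<^sup>2) * emeasure lborel {min (p i) t<..min (p (Suc i)) t})"
    by (subst nn_integral_sum) (auto simp: nn_integral_cmult_indicator)
  also have "\<dots> = (\<Sum>i<n. ennreal ((\<xi> i \<omega>)\<^sup>2 * (min (p (Suc i)) t - min (p i) t)))"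
  proof (rule sum.cong)
    fix i assume "i \<in> {..<n}"
    then have "min (p i) t \<le> min (p (Suc i)) t"
      using si by (simp add: simple_integrand_def min.coboundedI1)
    then show "ennreal ((\<xi> i \<omega>)\<^sup>2) * emeasure lborel {min (p i) t<..min (p (Suc i)) t}
        = ennreal ((\<xi> i \<omega>)\<^sup>2 * (min (p (Suc i)) t - min (p i) t))"
      by (subst emeasure_lborel_Ioc) (auto simp: ennreal_mult)
  qed simp
  also have "\<dots> = ennreal (simple_energy n p \<xi> t \<omega>)"
    unfolding simple_energy_def
    using si by (intro sum_ennreal) (auto simp: simple_integrand_def intro!: mult_nonneg_nonneg min.mono)
  finally show ?thesis .
qed

text \<open>Finiteness at every index of the subsequence is included, because the extended nonnegative
  values are later converted to reals.\<close>

lemma nn_integral_tendsto_0_AE_subseq: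
  fixes W :: "nat \<Rightarrow> 'a \<Rightarrow> ennreal"
  assumes W: "\<And>m. W m \<in> borel_measurable M"
    and lim: "(\<lambda>m. \<integral>\<^sup>+\<omega>. W m \<omega> \<partial>M) \<longlonglongrightarrow> 0"
  shows "\<exists>r. AE \<omega> in M. (\<forall>k. W (r k) \<omega> < \<infinity>) \<and> (\<lambda>k. W (r k) \<omega>) \<longlonglongrightarrow> 0"
proof -
  note [measurable] = W
  have "eventually (\<lambda>m. (\<integral>\<^sup>+\<omega>. W m \<omega> \<partial>M) < 1) sequentially"
    using lim by (rule order_tendstoD) simp
  then obtain m0 where m0: "\<And>m. m0 \<le> m \<Longrightarrow> (\<integral>\<^sup>+\<omega>. W m \<omega> \<partial>M) < 1"
    by (auto simp: eventually_sequentially)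
  have fin: "(\<integral>\<^sup>+\<omega>. W (m + m0) \<omega> \<partial>M) < \<infinity>" for m
    using m0[of "m + m0"] by (metis ennreal_one_less_top infinity_ennreal_def le_add2 order_less_trans)
  have AEfin: "AE \<omega> in M. W (m + m0) \<omega> < \<infinity>" for m
    using nn_integral_noteq_infinite[OF W, of "m + m0"] fin[of m] by (auto simp: less_top)
  define u where "u m \<omega> = enn2real (W (m + m0) \<omega>)" for m \<omega>
  have eq: "(\<integral>\<^sup>+\<omega>. ennreal (u m \<omega>) \<partial>M) = (\<integral>\<^sup>+\<omega>. W (m + m0) \<omega> \<partial>M)" for m
    by (rule nn_integral_cong_AE) (use AEfin[of m] in eventually_elim, simp add: u_def less_top)
  have um: "u m \<in> borel_measurable M" for m unfolding u_def by measurable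
  have int: "integrable M (u m)" for m
    by (rule integrableI_nonneg) (use um fin[of m] eq[of m] in \<open>auto simp: u_def\<close>)
  have "(\<lambda>m. \<integral>\<omega>. norm (u m \<omega>) \<partial>M) = (\<lambda>m. enn2real (\<integral>\<^sup>+\<omega>. W (m + m0) \<omega> \<partial>M))"
    by (rule ext) (subst eq[symmetric], subst integral_eq_nn_integral, auto simp: u_def um[unfolded u_def])
  moreover have "\<dots> \<longlonglongrightarrow> enn2real 0"
    using LIMSEQ_ignore_initial_segment[OF lim, of m0] by (intro tendsto_enn2real) auto
  ultimately have "(\<lambda>m. \<integral>\<omega>. norm (u m \<omega>) \<partial>M) \<longlonglongrightarrow> 0" by simp
  from tendsto_L1_AE_subseq[OF int this] obtain r :: "nat \<Rightarrow> nat"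
    where r: "AE \<omega> in M. (\<lambda>k. u (r k) \<omega>) \<longlonglongrightarrow> 0" by auto
  have "AE \<omega> in M. \<forall>k. W (r k + m0) \<omega> < \<infinity>"
    using AEfin by (simp add: AE_all_countable)
  with r have "AE \<omega> in M. (\<forall>k. W (r k + m0) \<omega> < \<infinity>) \<and> (\<lambda>k. W (r k + m0) \<omega>) \<longlonglongrightarrow> 0"
  proof eventually_elim
    case (elim \<omega>)
    then have "(\<lambda>k. ennreal (u (r k) \<omega>)) \<longlonglongrightarrow> ennreal 0" by (intro tendsto_ennrealI)
    then show ?case using elim by (simp add: u_def less_top)
  qed
  then show ?thesis by (intro exI[of _ "\<lambda>k. r k + m0"])
qed

text \<open>The coefficient of \<open>y\<^sup>2\<close> is close to one, at the price of a large multiple of the error. Thus the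
  energies of approximating integrands have upper limit at most \<open>(1 + \<epsilon>)\<close> times the energy of the
  limit.\<close>

lemma square_le_perturbed:
  fixes x y \<epsilon> :: real
  assumes "0 < \<epsilon>"
  shows "x\<^sup>2 \<le> (1 + \<epsilon>) * y\<^sup>2 + (1 + 1 / \<epsilon>) * (x - y)\<^sup>2"
proof -
  have "0 \<le> (\<epsilon> * y - (x - y))\<^sup>2 / \<epsilon>" using assms by simp
  also have "\<dots> = (1 + \<epsilon>) * y\<^sup>2 + (1 + 1 / \<epsilon>) * (x - y)\<^sup>2 - x\<^sup>2"
    using assms by (simp add: power2_eq_square field_simps)
  finally show ?thesis by simp
qed

text \<open>The approximating simple integrands may be random. Their integrals satisfy the exponential
  identity above, which survives when the energy is replaced by the larger quantity \<open>Q\<close>, and \<open>Q\<close>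
  converges to the deterministic value \<open>(1 + \<epsilon>) v\<close>.\<close>

lemma ito_integral_sub_gaussian:
  assumes fil: "filtered_prob_space M F" and BM: "brownian_motion M F B"
    and t: "0 \<le> t" and ito: "ito_integral M F B (\<lambda>s \<omega>. a s) t X"
    and a2: "set_integrable lborel {0..t} (\<lambda>s. (a s)\<^sup>2)"
  shows "sub_gaussian M X (LBINT s:{0..t}. (a s)\<^sup>2)"
proof -
  interpret prob_space M using fil by (simp add: filtered_prob_space_def)
  have X [measurable]: "X \<in> borel_measurable M" using ito by (simp add: ito_integral_def)
  obtain n p \<xi> where si: "\<And>m. simple_integrand M F (n m) (p m) (\<xi> m)"
    and lim1: "(\<lambda>m. \<integral>\<^sup>+\<omega>. (\<integral>\<^sup>+s\<in>{0..t}. ennreal ((simple_process (n m) (p m) (\<xi> m) s \<omega> - a s)\<^sup>2)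
               \<partial>lborel) \<partial>M) \<longlonglongrightarrow> 0"
    and lim2: "(\<lambda>m. \<integral>\<^sup>+\<omega>. ennreal ((simple_integral B (n m) (p m) (\<xi> m) t \<omega> - X \<omega>)\<^sup>2) \<partial>M) \<longlonglongrightarrow> 0"
    using ito unfolding ito_integral_def by blast
  \<comment> \<open>The integrand is known to be measurable only on \<open>{0..t}\<close>.\<close>
  define a' where "a' s = indicator {0..t} s * a s" for s
  have a' [measurable]: "a' \<in> borel_measurable borel"
  proof -
    obtain \<omega>0 where "\<omega>0 \<in> space M" using not_empty by auto
    moreover have "(\<lambda>(s, \<omega>). indicator {0..t} s * a s) \<in> borel_measurable (lborel \<Otimes>\<^sub>M M)"
      using ito by (simp add: ito_integral_def)
    ultimately have "(\<lambda>s. indicator {0..t} s * a s) \<in> borel_measurable lborel"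
      by (auto dest: measurable_Pair1)
    then show ?thesis by (simp add: a'_def[abs_def])
  qed
  define v where "v = (LBINT s:{0..t}. (a s)\<^sup>2)"
  have v: "(\<integral>\<^sup>+s\<in>{0..t}. ennreal ((a' s)\<^sup>2) \<partial>lborel) = ennreal v"
  proof -
    have "(\<integral>\<^sup>+s\<in>{0..t}. ennreal ((a' s)\<^sup>2) \<partial>lborel) = (\<integral>\<^sup>+s. ennreal (indicator {0..t} s *\<^sub>R (a s)\<^sup>2) \<partial>lborel)"
      by (intro nn_integral_cong) (simp add: a'_def indicator_def)
    also have "\<dots> = ennreal v"
      unfolding v_def set_lebesgue_integral_def using a2
      by (intro nn_integral_eq_integral) (auto simp: set_integrable_def)
    finally show ?thesis .
  qed
  have v0: "0 \<le> v" unfolding v_def set_lebesgue_integral_def by (intro integral_nonneg_AE) auto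
  have \<xi>m: "\<xi> m i \<in> borel_measurable M" if "i < n m" for m i
    using si[of m] that by (intro filtered_borel_measurable[OF fil]) (auto simp: simple_integrand_def)
  have p0: "0 \<le> p m i" if "i \<le> n m" for m i
    using simple_integrand_mono[OF si[of m], of 0 i] si[of m] that by (simp add: simple_integrand_def)
  have Bm: "B (min (p m i) t) \<in> borel_measurable M" if "i \<le> n m" for m i
    using BM p0[OF that] t
    by (intro filtered_borel_measurable[OF fil, of _ "min (p m i) t"]) (simp add: brownian_motion_def)
  let ?S = "\<lambda>m. simple_integral B (n m) (p m) (\<xi> m) t"
  have Sm [measurable]: "?S m \<in> borel_measurable M" for m
    unfolding simple_integral_def
    by (intro borel_measurable_sum borel_measurable_times borel_measurable_diff \<xi>m Bm) auto
  define D where "D m \<omega> = (\<integral>\<^sup>+s\<in>{0..t}. ennreal ((simple_process (n m) (p m) (\<xi> m) s \<omega> - a' s)\<^sup>2) \<partial>lborel)" for m \<omega>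
  have Dm [measurable]: "D m \<in> borel_measurable M" for m
  proof -
    have "(\<lambda>(\<omega>, s). simple_process (n m) (p m) (\<xi> m) s \<omega>) \<in> borel_measurable (M \<Otimes>\<^sub>M lborel)"
      unfolding simple_process_def case_prod_beta
    proof (intro borel_measurable_sum borel_measurable_times)
      fix i assume "i \<in> {..<n m}"
      then have [measurable]: "\<xi> m i \<in> borel_measurable M" by (simp add: \<xi>m)
      show "(\<lambda>x. \<xi> m i (fst x)) \<in> borel_measurable (M \<Otimes>\<^sub>M lborel)" by measurable
    qed measurable
    then have [measurable]: "(\<lambda>x. simple_process (n m) (p m) (\<xi> m) (snd x) (fst x)) \<in> borel_measurable (M \<Otimes>\<^sub>M lborel)"
      by (simp add: case_prod_beta)
    show ?thesis unfolding D_def by measurable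
  qed
  have lim1': "(\<lambda>m. \<integral>\<^sup>+\<omega>. D m \<omega> \<partial>M) \<longlonglongrightarrow> 0"
  proof -
    have "D m \<omega> = (\<integral>\<^sup>+s\<in>{0..t}. ennreal ((simple_process (n m) (p m) (\<xi> m) s \<omega> - a s)\<^sup>2) \<partial>lborel)" for m \<omega>
      unfolding D_def by (intro nn_integral_cong) (simp add: a'_def indicator_def)
    with lim1 show ?thesis by simp
  qed
  \<comment> \<open>One sequence carries both convergences, so that a single subsequence serves for both.\<close>
  define W where "W m \<omega> = D m \<omega> + ennreal ((?S m \<omega> - X \<omega>)\<^sup>2)" for m \<omega>
  have "(\<lambda>m. \<integral>\<^sup>+\<omega>. W m \<omega> \<partial>M) \<longlonglongrightarrow> 0 + 0"
  proof -
    have "(\<integral>\<^sup>+\<omega>. W m \<omega> \<partial>M) = (\<integral>\<^sup>+\<omega>. D m \<omega> \<partial>M) + (\<integral>\<^sup>+\<omega>. ennreal ((?S m \<omega> - X \<omega>)\<^sup>2) \<partial>M)" for m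
      unfolding W_def by (rule nn_integral_add) measurable
    then show ?thesis using tendsto_add[OF lim1' lim2] by simp
  qed
  then obtain r where r: "AE \<omega> in M. (\<forall>k. W (r k) \<omega> < \<infinity>) \<and> (\<lambda>k. W (r k) \<omega>) \<longlonglongrightarrow> 0"
    using nn_integral_tendsto_0_AE_subseq[of W M] unfolding W_def by auto
  show ?thesis
    unfolding v_def[symmetric]
  proof (rule sub_gaussian_right_limit[where w = v])
    fix \<epsilon> :: real assume \<epsilon>: "0 < \<epsilon>"
    define Q where "Q k \<omega> = (1 + \<epsilon>) * v + (1 + 1 / \<epsilon>) * enn2real (D (r k) \<omega>)" for k \<omega>
    show "sub_gaussian M X (v + \<epsilon> * v)"
    proof (rule sub_gaussian_limit[where Xn = "\<lambda>k. ?S (r k)" and Q = Q])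
      show "X \<in> borel_measurable M" "?S (r k) \<in> borel_measurable M" "Q k \<in> borel_measurable M" for k
        unfolding Q_def by measurable
      fix k and \<theta> :: real
      have "AE \<omega> in M. simple_energy (n (r k)) (p (r k)) (\<xi> (r k)) t \<omega> \<le> Q k \<omega>"
        using r
      proof eventually_elim
        case (elim \<omega>)
        let ?f = "\<lambda>s. simple_process (n (r k)) (p (r k)) (\<xi> (r k)) s \<omega>"
        have fm [measurable]: "?f \<in> borel_measurable borel" unfolding simple_process_def by measurable
        have fin: "D (r k) \<omega> < \<infinity>" using elim by (auto simp: W_def less_top)
        have "ennreal (simple_energy (n (r k)) (p (r k)) (\<xi> (r k)) t \<omega>) = (\<integral>\<^sup>+s\<in>{0..t}. ennreal ((?f s)\<^sup>2) \<partial>lborel)"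
          by (rule simple_energy_eq_nn_integral[OF si t, symmetric])
        also have "\<dots> \<le> (\<integral>\<^sup>+s. ennreal (1 + \<epsilon>) * (ennreal ((a' s)\<^sup>2) * indicator {0..t} s)
             + ennreal (1 + 1 / \<epsilon>) * (ennreal ((?f s - a' s)\<^sup>2) * indicator {0..t} s) \<partial>lborel)"
        proof (intro nn_integral_mono)
          fix s
          have "ennreal ((?f s)\<^sup>2) \<le> ennreal ((1 + \<epsilon>) * (a' s)\<^sup>2 + (1 + 1 / \<epsilon>) * (?f s - a' s)\<^sup>2)"
            by (intro ennreal_leI square_le_perturbed \<epsilon>)
          also have "\<dots> = ennreal (1 + \<epsilon>) * ennreal ((a' s)\<^sup>2) + ennreal (1 + 1 / \<epsilon>) * ennreal ((?f s - a' s)\<^sup>2)"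
            using \<epsilon> by (subst ennreal_plus) (auto simp: ennreal_mult)
          finally show "ennreal ((?f s)\<^sup>2) * indicator {0..t} s \<le> ennreal (1 + \<epsilon>) * (ennreal ((a' s)\<^sup>2) * indicator {0..t} s)
             + ennreal (1 + 1 / \<epsilon>) * (ennreal ((?f s - a' s)\<^sup>2) * indicator {0..t} s)"
            by (simp add: indicator_def)
        qed
        also have "\<dots> = ennreal (1 + \<epsilon>) * ennreal v + ennreal (1 + 1 / \<epsilon>) * D (r k) \<omega>"
          unfolding v[symmetric] D_def by (subst nn_integral_add) (auto simp: nn_integral_cmult)
        also have "\<dots> = ennreal (Q k \<omega>)"
          using fin v0 \<epsilon> unfolding Q_def by (simp add: ennreal_mult less_top)
        finally show ?case using v0 \<epsilon> by (subst (asm) ennreal_le_iff) (auto simp: Q_def)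
      qed
      then have "(\<integral>\<^sup>+\<omega>. ennreal (exp (\<theta> * ?S (r k) \<omega> - \<theta>\<^sup>2 * Q k \<omega> / 2)) \<partial>M)
          \<le> (\<integral>\<^sup>+\<omega>. ennreal (exp (\<theta> * ?S (r k) \<omega> - \<theta>\<^sup>2 * simple_energy (n (r k)) (p (r k)) (\<xi> (r k)) t \<omega> / 2)) \<partial>M)"
        by (intro nn_integral_mono_AE) (auto elim!: eventually_mono intro!: ennreal_leI mult_left_mono)
      also have "\<dots> = 1" by (rule simple_exponential_martingale[OF fil BM si t])
      finally show "(\<integral>\<^sup>+\<omega>. ennreal (exp (\<theta> * ?S (r k) \<omega> - \<theta>\<^sup>2 * Q k \<omega> / 2)) \<partial>M) \<le> 1" .
    next
      show "AE \<omega> in M. (\<lambda>k. ?S (r k) \<omega>) \<longlonglongrightarrow> X \<omega>"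
        using r
      proof eventually_elim
        case (elim \<omega>)
        have "(\<lambda>k. ennreal ((?S (r k) \<omega> - X \<omega>)\<^sup>2)) \<longlonglongrightarrow> ennreal 0"
          by (rule tendsto_sandwich[of "\<lambda>_. 0" _ _ "\<lambda>k. W (r k) \<omega>"]) (use elim in \<open>auto simp: W_def\<close>)
        then have "(\<lambda>k. (?S (r k) \<omega> - X \<omega>)\<^sup>2) \<longlonglongrightarrow> 0" by (subst (asm) tendsto_ennreal_iff) auto
        then have "(\<lambda>k. ?S (r k) \<omega> - X \<omega>) \<longlonglongrightarrow> 0" using tendsto_real_sqrt by (fastforce simp: tendsto_rabs_zero_iff)
        then show ?case by (simp add: LIM_zero_iff)
      qed
      show "AE \<omega> in M. (\<lambda>k. Q k \<omega>) \<longlonglongrightarrow> v + \<epsilon> * v"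
        using r
      proof eventually_elim
        case (elim \<omega>)
        have "(\<lambda>k. D (r k) \<omega>) \<longlonglongrightarrow> 0"
          by (rule tendsto_sandwich[of "\<lambda>_. 0" _ _ "\<lambda>k. W (r k) \<omega>"]) (use elim in \<open>auto simp: W_def\<close>)
        then have "(\<lambda>k. enn2real (D (r k) \<omega>)) \<longlonglongrightarrow> enn2real 0"
          by (intro tendsto_enn2real) auto
        then have "(\<lambda>k. Q k \<omega>) \<longlonglongrightarrow> (1 + \<epsilon>) * v + (1 + 1 / \<epsilon>) * 0"
          unfolding Q_def by (intro tendsto_add tendsto_mult tendsto_const) simp
        then show ?case by (simp add: algebra_simps)
      qed
    qed
  qed
qed

section \<open>The pathwise integral against fractional Brownian motion\<close>

text \<open>In the definition of a Gaussian process the times in a linear combination are distinct. Here the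
  same time may occur for several indices, whose coefficients are then added up.\<close>

lemma centred_gaussian_process_combination:
  assumes X: "centred_gaussian_process M X R" and I: "finite I" and u: "\<And>i. i \<in> I \<Longrightarrow> 0 \<le> u i"
  shows "centred_gaussian M (\<lambda>\<omega>. \<Sum>i\<in>I. d i * X (u i) \<omega>) (\<Sum>i\<in>I. \<Sum>j\<in>I. d i * d j * R (u i) (u j))"
proof -
  define c where "c t = (\<Sum>i\<in>{i \<in> I. u i = t}. d i)" for t
  have group: "(\<Sum>t\<in>u ` I. c t * f t) = (\<Sum>i\<in>I. d i * f (u i))" for f :: "real \<Rightarrow> real"
  proof -
    have "(\<Sum>t\<in>u ` I. c t * f t) = (\<Sum>t\<in>u ` I. \<Sum>i\<in>{i \<in> I. u i = t}. d i * f (u i))"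
      unfolding c_def sum_distrib_right by (intro sum.cong) auto
    also have "\<dots> = (\<Sum>i\<in>I. d i * f (u i))" using I by (intro sum.group) auto
    finally show ?thesis .
  qed
  have "centred_gaussian M (\<lambda>\<omega>. \<Sum>t\<in>u ` I. c t * X t \<omega>) (\<Sum>s\<in>u ` I. \<Sum>t\<in>u ` I. c s * c t * R s t)"
    using X I u unfolding centred_gaussian_process_def by auto
  also have "(\<lambda>\<omega>. \<Sum>t\<in>u ` I. c t * X t \<omega>) = (\<lambda>\<omega>. \<Sum>i\<in>I. d i * X (u i) \<omega>)"
    by (rule ext) (rule group)
  also have "(\<Sum>s\<in>u ` I. \<Sum>t\<in>u ` I. c s * c t * R s t) = (\<Sum>s\<in>u ` I. c s * (\<Sum>t\<in>u ` I. c t * R s t))"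
    by (simp add: sum_distrib_left mult.assoc)
  also have "\<dots> = (\<Sum>i\<in>I. \<Sum>j\<in>I. d i * d j * R (u i) (u j))"
    unfolding group by (simp add: sum_distrib_left mult.assoc)
  finally show ?thesis .
qed

definition increment_covariance :: "(real \<Rightarrow> real \<Rightarrow> real) \<Rightarrow> (nat \<Rightarrow> real) \<Rightarrow> nat \<Rightarrow> nat \<Rightarrow> real" where
  "increment_covariance R u i j
     = R (u (Suc i)) (u (Suc j)) - R (u (Suc i)) (u j) - R (u i) (u (Suc j)) + R (u i) (u j)"

text \<open>Each increment contributes its two end points, so the sum runs over pairs of an interval and a
  Boolean that selects the right or the left end point.\<close>

lemma centred_gaussian_process_increments:
  assumes X: "centred_gaussian_process M X R" and u: "\<And>i. i \<le> n \<Longrightarrow> 0 \<le> u i"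
  shows "centred_gaussian M (\<lambda>\<omega>. \<Sum>i<n. d i * (X (u (Suc i)) \<omega> - X (u i) \<omega>))
     (\<Sum>i<n. \<Sum>j<n. d i * d j * increment_covariance R u i j)"
proof -
  let ?I = "{..<n} \<times> (UNIV :: bool set)"
  let ?d = "\<lambda>(i, e). if e then d i else - d i" and ?u = "\<lambda>(i, e). if e then u (Suc i) else u i"
  have split: "(\<Sum>q\<in>?I. f q) = (\<Sum>i<n. f (i, True) + f (i, False))" for f :: "nat \<times> bool \<Rightarrow> real"
  proof -
    have "(\<Sum>q\<in>?I. f q) = (\<Sum>i<n. \<Sum>e\<in>UNIV. f (i, e))" by (simp add: sum.cartesian_product)
    then show ?thesis by (simp add: UNIV_bool add.commute)
  qed
  have "centred_gaussian M (\<lambda>\<omega>. \<Sum>q\<in>?I. ?d q * X (?u q) \<omega>) (\<Sum>q\<in>?I. \<Sum>r\<in>?I. ?d q * ?d r * R (?u q) (?u r))"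
    using X by (rule centred_gaussian_process_combination) (use u in \<open>auto split: if_splits\<close>)
  moreover have "(\<Sum>q\<in>?I. ?d q * X (?u q) \<omega>) = (\<Sum>i<n. d i * (X (u (Suc i)) \<omega> - X (u i) \<omega>))" for \<omega>
    unfolding split by (simp add: algebra_simps)
  moreover have "(\<Sum>q\<in>?I. \<Sum>r\<in>?I. ?d q * ?d r * R (?u q) (?u r))
      = (\<Sum>i<n. \<Sum>j<n. d i * d j * increment_covariance R u i j)"
    unfolding split
    by (simp add: increment_covariance_def sum.distrib[symmetric] algebra_simps)
  ultimately show ?thesis by simp
qed

text \<open>Midpoint convexity of \<open>\<lambda>x. \<bar>x\<bar> powr q\<close>; it makes the increments of fractional Brownian motion
  nonnegatively correlated.\<close>

lemma abs_powr_midpoint: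
  fixes x d q :: real
  assumes q: "1 \<le> q"
  shows "2 * \<bar>x\<bar> powr q \<le> \<bar>x + d\<bar> powr q + \<bar>x - d\<bar> powr q"
proof -
  have mid: "2 * ((y + z) / 2) powr q \<le> y powr q + z powr q" if "0 \<le> y" "0 \<le> z" for y z :: real
  proof (cases "y = 0 \<or> z = 0")
    case True
    have half: "2 * (w / 2) powr q \<le> w powr q" if "0 \<le> w" for w :: real
    proof -
      have "(2::real) powr 1 \<le> 2 powr q" using q by (intro powr_mono) auto
      then have "2 * (w powr q / 2 powr q) \<le> 2 powr q * (w powr q / 2 powr q)" by (intro mult_right_mono) auto
      then have "2 * (w powr q / 2 powr q) \<le> w powr q" by simp
      then show ?thesis using that by (simp add: powr_divide)
    qed
    from True show ?thesis using half[of y] half[of z] that by auto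
  next
    case False
    then have "((1 - 1/2) *\<^sub>R y + (1/2) *\<^sub>R z) powr q \<le> (1 - 1/2) * y powr q + (1/2) * z powr q"
      using that by (intro convex_onD[OF powr_convex[OF q]]) auto
    moreover have "(1 - 1/2) *\<^sub>R y + (1/2) *\<^sub>R z = (y + z) / 2" by simp
    ultimately have "((y + z) / 2) powr q \<le> (1 - 1/2) * y powr q + (1/2) * z powr q" by (simp only:)
    then show ?thesis by simp
  qed
  have "\<bar>x\<bar> powr q \<le> ((\<bar>x + d\<bar> + \<bar>x - d\<bar>) / 2) powr q"
    using q by (intro powr_mono2) auto
  with mid[of "\<bar>x + d\<bar>" "\<bar>x - d\<bar>"] show ?thesis by simp
qed

lemma powr_diff_le:
  fixes s r t q :: real
  assumes "1 \<le> q" "0 \<le> s" "s \<le> r" "r \<le> t"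
  shows "r powr q - s powr q \<le> q * t powr (q - 1) * (r - s)"
proof (cases "s = r")
  case False
  then have "s < r" using assms by simp
  have cont: "continuous_on {s..r} (\<lambda>x. x powr q)"
    using assms by (intro continuous_on_powr' continuous_intros) auto
  have diff: "(\<lambda>x. x powr q) differentiable at x" if "s < x" for x
    using that assms by (auto intro!: derivative_eq_intros exI simp: real_differentiable_def)
  obtain l z where z: "s < z" "z < r" "DERIV (\<lambda>x. x powr q) z :> l"
      and eq: "r powr q - s powr q = (r - s) * l"
    using MVT[OF \<open>s < r\<close> cont diff] by blast
  have "DERIV (\<lambda>x. x powr q) z :> q * z powr (q - 1)"
    using z assms by (auto intro!: derivative_eq_intros)
  then have "l = q * z powr (q - 1)" using z(3) DERIV_unique by blast
  moreover have "z powr (q - 1) \<le> t powr (q - 1)"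
    using z assms by (intro powr_mono2) auto
  ultimately have "l \<le> q * t powr (q - 1)" using assms by (simp add: mult_left_mono)
  then have "(r - s) * l \<le> (r - s) * (q * t powr (q - 1))" using assms by (intro mult_left_mono) auto
  then show ?thesis using eq by (simp add: mult.commute)
qed simp

definition fbm_covariance :: "real \<Rightarrow> real \<Rightarrow> real \<Rightarrow> real" where
  "fbm_covariance H s t = (s powr (2 * H) + t powr (2 * H) - \<bar>t - s\<bar> powr (2 * H)) / 2"

text \<open>On a uniform grid the covariance is half a second difference of \<open>\<lambda>x. \<bar>x\<bar> powr (2 * H)\<close>.\<close>

lemma fbm_increment_covariance_nonneg:
  assumes "1 / 2 \<le> H"
  shows "0 \<le> increment_covariance (fbm_covariance H) (\<lambda>i. real i * \<delta>) i j"
proof -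
  let ?x = "(real j - real i) * \<delta>" and ?q = "2 * H"
  have "increment_covariance (fbm_covariance H) (\<lambda>i. real i * \<delta>) i j
      = (\<bar>?x + \<delta>\<bar> powr ?q + \<bar>?x - \<delta>\<bar> powr ?q - 2 * \<bar>?x\<bar> powr ?q) / 2"
  proof -
    have e: "real (Suc j) * \<delta> - real (Suc i) * \<delta> = ?x" "real j * \<delta> - real (Suc i) * \<delta> = ?x - \<delta>"
      "real (Suc j) * \<delta> - real i * \<delta> = ?x + \<delta>" "real j * \<delta> - real i * \<delta> = ?x"
      by (simp_all add: algebra_simps)
    show ?thesis unfolding increment_covariance_def fbm_covariance_def e by argo
  qed
  then show ?thesis using abs_powr_midpoint[of ?q ?x \<delta>] assms by simp
qed

lemma fbm_increment_covariance_commute: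
  "increment_covariance (fbm_covariance H) u i j = increment_covariance (fbm_covariance H) u j i"
proof -
  have "fbm_covariance H s t = fbm_covariance H t s" for s t
    by (simp add: fbm_covariance_def abs_minus_commute add.commute)
  then show ?thesis unfolding increment_covariance_def by (simp add: algebra_simps)
qed

text \<open>The row telescopes to the covariance of one increment with the value at the final time. This is a
  combination of two differences of \<open>\<lambda>x. x powr (2 * H)\<close> over intervals of length \<open>\<delta>\<close>, each bounded
  by the mean value theorem.\<close>

lemma fbm_increment_covariance_row_sum:
  assumes H: "1 / 2 \<le> H" and \<delta>: "0 \<le> \<delta>" and i: "i < n"
  shows "(\<Sum>j<n. increment_covariance (fbm_covariance H) (\<lambda>i. real i * \<delta>) i j)
    \<le> 2 * H * (real n * \<delta>) powr (2 * H - 1) * \<delta>"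
proof -
  let ?R = "fbm_covariance H" and ?q = "2 * H" and ?t = "real n * \<delta>"
  let ?s = "real i * \<delta>" and ?r = "real (Suc i) * \<delta>"
  have rt: "?r \<le> ?t" using i \<delta> by (intro mult_right_mono) auto
  have s0: "0 \<le> ?s" and sr: "?s \<le> ?r" using \<delta> by (auto intro: mult_right_mono)
  have "(\<Sum>j<n. increment_covariance ?R (\<lambda>i. real i * \<delta>) i j)
      = (\<Sum>j<n. (?R ?r (real (Suc j) * \<delta>) - ?R ?s (real (Suc j) * \<delta>)) - (?R ?r (real j * \<delta>) - ?R ?s (real j * \<delta>)))"
    by (simp add: increment_covariance_def algebra_simps)
  also have "\<dots> = (?R ?r ?t - ?R ?s ?t) - (?R ?r 0 - ?R ?s 0)"
    by (subst sum_lessThan_telescope) simp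
  also have "\<dots> = ((?r powr ?q - ?s powr ?q) + ((?t - ?s) powr ?q - (?t - ?r) powr ?q)) / 2"
    using s0 sr rt unfolding fbm_covariance_def by (simp del: of_nat_Suc) argo
  also have "\<dots> \<le> (?q * ?t powr (?q - 1) * (?r - ?s) + ?q * ?t powr (?q - 1) * ((?t - ?s) - (?t - ?r))) / 2"
    using H s0 sr rt by (intro divide_right_mono add_mono powr_diff_le) auto
  also have "\<dots> = ?q * ?t powr (?q - 1) * \<delta>"
    by (simp add: algebra_simps)
  finally show ?thesis .
qed

text \<open>Schur's test: by \<open>2 d\<^sub>i d\<^sub>j \<le> d\<^sub>i\<^sup>2 + d\<^sub>j\<^sup>2\<close> and nonnegative symmetric entries, the quadratic form is
  at most the largest row sum times \<open>\<Sum> d\<^sub>i\<^sup>2\<close>.\<close>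

lemma fbm_riemann_sum_variance:
  assumes H: "1 / 2 \<le> H" and \<delta>: "0 \<le> \<delta>"
  shows "(\<Sum>i<n. \<Sum>j<n. d i * d j * increment_covariance (fbm_covariance H) (\<lambda>i. real i * \<delta>) i j)
    \<le> 2 * H * (real n * \<delta>) powr (2 * H - 1) * (\<Sum>i<n. (d i)\<^sup>2 * \<delta>)"
proof -
  let ?c = "increment_covariance (fbm_covariance H) (\<lambda>i. real i * \<delta>)"
  have "(\<Sum>i<n. \<Sum>j<n. d i * d j * ?c i j) \<le> (\<Sum>i<n. \<Sum>j<n. (d i)\<^sup>2 / 2 * ?c i j + (d j)\<^sup>2 / 2 * ?c i j)"
  proof (intro sum_mono)
    fix i j
    have "d i * d j \<le> (d i)\<^sup>2 / 2 + (d j)\<^sup>2 / 2" using sum_squares_bound[of "d i" "d j"] by simp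
    from mult_right_mono[OF this fbm_increment_covariance_nonneg[OF H, of \<delta> i j]]
    show "d i * d j * ?c i j \<le> (d i)\<^sup>2 / 2 * ?c i j + (d j)\<^sup>2 / 2 * ?c i j"
      by (simp add: distrib_right)
  qed
  also have "\<dots> = (\<Sum>i<n. \<Sum>j<n. (d i)\<^sup>2 / 2 * ?c i j) + (\<Sum>i<n. \<Sum>j<n. (d j)\<^sup>2 / 2 * ?c i j)"
    by (simp add: sum.distrib)
  also have "(\<Sum>i<n. \<Sum>j<n. (d j)\<^sup>2 / 2 * ?c i j) = (\<Sum>j<n. \<Sum>i<n. (d j)\<^sup>2 / 2 * ?c j i)"
    by (subst sum.swap) (simp add: fbm_increment_covariance_commute)
  also have "(\<Sum>i<n. \<Sum>j<n. (d i)\<^sup>2 / 2 * ?c i j) + \<dots> = (\<Sum>i<n. (d i)\<^sup>2 * (\<Sum>j<n. ?c i j))"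
    by (simp add: sum.distrib[symmetric] sum_distrib_left)
  also have "\<dots> \<le> (\<Sum>i<n. (d i)\<^sup>2 * (2 * H * (real n * \<delta>) powr (2 * H - 1) * \<delta>))"
    by (intro sum_mono mult_left_mono fbm_increment_covariance_row_sum H \<delta>) auto
  also have "\<dots> = 2 * H * (real n * \<delta>) powr (2 * H - 1) * (\<Sum>i<n. (d i)\<^sup>2 * \<delta>)"
    unfolding sum_distrib_left by (intro sum.cong) (auto simp: algebra_simps)
  finally show ?thesis .
qed

text \<open>A function cannot exceed its mean everywhere. Tags chosen in this way keep the Riemann sums of
  \<open>b\<^sup>2\<close> below its integral although \<open>b\<close> is merely square integrable.\<close>

lemma set_integral_attains_mean_bound:
  fixes f :: "real \<Rightarrow> real"
  assumes uv: "u < v" and f: "set_integrable lborel {u<..v} f"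
  shows "\<exists>x\<in>{u..v}. f x * (v - u) \<le> (LBINT s:{u<..v}. f s)"
proof (rule ccontr)
  define I where "I = (LBINT s:{u<..v}. f s)"
  assume "\<not> ?thesis"
  then have less: "I / (v - u) < f x" if "x \<in> {u..v}" for x
    using that uv by (auto simp: I_def field_simps not_le)
  let ?h = "\<lambda>s. indicator {u<..v} s *\<^sub>R (f s - I / (v - u))"
  have const: "set_integrable lborel {u<..v} (\<lambda>s. I / (v - u))"
    using uv by (simp add: set_integrable_def)
  have "(LBINT s:{u<..v}. I / (v - u)) = I"
    using uv by (simp add: set_lebesgue_integral_def)
  then have "(LBINT s:{u<..v}. f s - I / (v - u)) = 0"
    using f const by (subst set_integral_diff) (auto simp: I_def)
  moreover have "integrable lborel ?h"
    using set_integral_diff(1)[OF f const] by (simp add: set_integrable_def)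
  moreover have "0 \<le> ?h s" for s
    using less[of s] by (auto simp: indicator_def less_imp_le)
  ultimately have "AE s in lborel. ?h s = 0"
    unfolding set_lebesgue_integral_def by (subst (asm) integral_nonneg_eq_0_iff_AE) auto
  then have "AE s in lborel. s \<notin> {u<..v}"
  proof eventually_elim
    case (elim s)
    then show ?case using less[of s] by (auto simp: indicator_def)
  qed
  then have "{u<..v} \<in> null_sets lborel" by (subst AE_iff_null_sets) auto
  then have "emeasure lborel {u<..v} = 0" by (rule null_setsD1)
  then show False using uv by simp
qed

lemma set_integral_mono_set_nonneg:
  fixes f :: "'a \<Rightarrow> real"
  assumes f: "set_integrable M B f" and A: "A \<in> sets M" "A \<subseteq> B" and nonneg: "\<And>x. x \<in> B \<Longrightarrow> 0 \<le> f x"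
  shows "(LINT x:A|M. f x) \<le> (LINT x:B|M. f x)"
  unfolding set_lebesgue_integral_def
proof (rule integral_mono)
  show "integrable M (\<lambda>x. indicator B x *\<^sub>R f x)" using f by (simp add: set_integrable_def)
  show "integrable M (\<lambda>x. indicator A x *\<^sub>R f x)"
    using set_integrable_subset[OF f A] by (simp add: set_integrable_def)
  show "indicator A x *\<^sub>R f x \<le> indicator B x *\<^sub>R f x" if "x \<in> space M" for x
    using A(2) nonneg[of x] by (auto simp: indicator_def)
qed

lemma set_integral_Ioc_sum:
  fixes f :: "real \<Rightarrow> real" and g :: "nat \<Rightarrow> real"
  assumes g: "\<And>i. i < n \<Longrightarrow> g i \<le> g (Suc i)" and f: "set_integrable lborel {g 0<..g n} f"
  shows "(\<Sum>i<n. LBINT s:{g i<..g (Suc i)}. f s) = (LBINT s:{g 0<..g n}. f s)"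
  using assms
proof (induction n)
  case (Suc n)
  have le: "g 0 \<le> g k" if "k \<le> n" for k
    using that by (induction k) (use Suc.prems(1) in \<open>auto intro: order.trans\<close>)
  have step: "g n \<le> g (Suc n)" using Suc.prems(1) by simp
  have un: "{g 0<..g (Suc n)} = {g 0<..g n} \<union> {g n<..g (Suc n)}" using le[of n] step by auto
  have int: "set_integrable lborel {g 0<..g n} f" "set_integrable lborel {g n<..g (Suc n)} f"
    by (rule set_integrable_subset[OF Suc.prems(2)]; use un in auto)+
  show ?case
    unfolding un using Suc int by (subst set_integral_Un) auto
qed (simp add: set_lebesgue_integral_def)

lemma uniform_tagged_division:
  assumes n: "0 < n" and \<delta>: "0 < \<delta>" and x: "\<And>i. i < n \<Longrightarrow> x i \<in> {real i * \<delta>..real (Suc i) * \<delta>}"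
  shows "(\<lambda>i. (x i, {real i * \<delta>..real (Suc i) * \<delta>})) ` {..<n} tagged_division_of {0..real n * \<delta>}"
proof (rule tagged_division_ofI)
  let ?K = "\<lambda>i. {real i * \<delta>..real (Suc i) * \<delta>}"
  let ?P = "(\<lambda>i. (x i, ?K i)) ` {..<n}"
  show "finite ?P" by simp
  fix y K assume yK: "(y, K) \<in> ?P"
  then obtain i where i: "i < n" "y = x i" "K = ?K i" by auto
  show "y \<in> K" using i x by auto
  show "\<exists>a b. K = cbox a b" using i by (auto simp: cbox_interval)
  have "real (Suc i) * \<delta> \<le> real n * \<delta>" using i \<delta> by (intro mult_right_mono) auto
  then show "K \<subseteq> {0..real n * \<delta>}" using i \<delta> by (auto intro: order.trans[OF _ \<open>real (Suc i) * \<delta> \<le> real n * \<delta>\<close>] order.trans[OF mult_nonneg_nonneg])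
  fix y' K' assume "(y', K') \<in> ?P" and ne: "(y, K) \<noteq> (y', K')"
  then obtain j where j: "j < n" "y' = x j" "K' = ?K j" by auto
  with ne i have "i \<noteq> j" by auto
  then have "real (Suc i) * \<delta> \<le> real j * \<delta> \<or> real (Suc j) * \<delta> \<le> real i * \<delta>"
    using \<delta> by (cases i j rule: linorder_cases) (auto simp del: of_nat_Suc intro!: mult_right_mono)
  then show "interior K \<inter> interior K' = {}" unfolding i j by (auto simp: interior_atLeastAtMost_real)
next
  have un: "(\<Union>i<k. {real i * \<delta>..real (Suc i) * \<delta>}) = {0..real k * \<delta>}" if "0 < k" for k
    using that
  proof (induction k)
    case (Suc k)
    show ?case
    proof (cases "k = 0")
      case False
      then have "(\<Union>i<Suc k. {real i * \<delta>..real (Suc i) * \<delta>}) = {0..real k * \<delta>} \<union> {real k * \<delta>..real (Suc k) * \<delta>}"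
        using Suc by (simp add: lessThan_Suc Un_commute)
      also have "\<dots> = {0..real (Suc k) * \<delta>}"
        using \<delta> by (intro ivl_disj_un_two_touch) (auto intro: mult_right_mono)
      finally show ?thesis .
    next
      case True
      show ?thesis unfolding True by (simp add: lessThan_Suc)
    qed
  qed simp
  show "\<Union> {K. \<exists>y. (y, K) \<in> (\<lambda>i. (x i, {real i * \<delta>..real (Suc i) * \<delta>})) ` {..<n}} = {0..real n * \<delta>}"
    unfolding un[OF n, symmetric] by auto
qed

lemma has_RS_integral_uniform_sums:
  assumes RS: "has_RS_integral f g 0 t I" and t: "0 < t"
    and x: "\<And>m i. i < Suc m \<Longrightarrow> x m i \<in> {real i * (t / real (Suc m))..real (Suc i) * (t / real (Suc m))}"
  shows "(\<lambda>m. \<Sum>i<Suc m. f (x m i) * (g (real (Suc i) * (t / real (Suc m))) - g (real i * (t / real (Suc m))))) \<longlonglongrightarrow> I"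
proof (rule LIMSEQ_I)
  fix \<epsilon> :: real assume "0 < \<epsilon>"
  with RS have "\<exists>\<eta>>0. \<forall>p. p tagged_division_of {0..t} \<and> (\<forall>(x, K)\<in>p. Sup K - Inf K < \<eta>) \<longrightarrow>
        \<bar>(\<Sum>(x, K)\<in>p. f x * (g (Sup K) - g (Inf K))) - I\<bar> < \<epsilon>"
    unfolding has_RS_integral_def by simp
  then obtain \<eta> where \<eta>: "0 < \<eta>" and "\<forall>p. p tagged_division_of {0..t} \<and> (\<forall>(x, K)\<in>p. Sup K - Inf K < \<eta>) \<longrightarrow>
        \<bar>(\<Sum>(x, K)\<in>p. f x * (g (Sup K) - g (Inf K))) - I\<bar> < \<epsilon>"
    by (elim exE conjE) (rule that)
  note close = this(2)[THEN spec, THEN mp, OF conjI]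
  have "(\<lambda>m. t * (1 / real (Suc m))) \<longlonglongrightarrow> t * 0"
    using LIMSEQ_inverse_real_of_nat by (intro tendsto_intros) (simp add: inverse_eq_divide)
  then have "eventually (\<lambda>m. t * (1 / real (Suc m)) < \<eta>) sequentially"
    using \<eta> by (intro order_tendstoD) auto
  then obtain m0 where m0: "\<And>m. m0 \<le> m \<Longrightarrow> t / real (Suc m) < \<eta>"
    by (auto simp: eventually_sequentially)
  show "\<exists>no. \<forall>m\<ge>no. norm ((\<Sum>i<Suc m. f (x m i) * (g (real (Suc i) * (t / real (Suc m))) - g (real i * (t / real (Suc m))))) - I) < \<epsilon>"
  proof (intro exI[of _ m0] allI impI)
    fix m assume "m0 \<le> m"
    define \<delta> where "\<delta> = t / real (Suc m)"
    have \<delta>: "0 < \<delta>" "\<delta> < \<eta>" and t_eq: "real (Suc m) * \<delta> = t"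
      using t m0[OF \<open>m0 \<le> m\<close>] by (auto simp: \<delta>_def)
    let ?K = "\<lambda>i. {real i * \<delta>..real (Suc i) * \<delta>}"
    let ?P = "(\<lambda>i. (x m i, ?K i)) ` {..<Suc m}"
    have le: "real i * \<delta> \<le> real (Suc i) * \<delta>" for i using \<delta> by (intro mult_right_mono) auto
    have Sup: "Sup (?K i) = real (Suc i) * \<delta>" and Inf: "Inf (?K i) = real i * \<delta>" for i
      using le[of i] by (auto intro!: cSup_atLeastAtMost cInf_atLeastAtMost simp del: of_nat_Suc)
    have "?P tagged_division_of {0..t}"
      using uniform_tagged_division[of "Suc m" \<delta> "x m"] \<delta> x[of _ m] unfolding t_eq \<delta>_def[symmetric] by blast
    moreover have "\<forall>(y, K)\<in>?P. Sup K - Inf K < \<eta>"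
      using \<delta> by (auto simp: Sup Inf simp del: of_nat_Suc) (simp add: algebra_simps)
    ultimately have "\<bar>(\<Sum>(y, K)\<in>?P. f y * (g (Sup K) - g (Inf K))) - I\<bar> < \<epsilon>" by (rule close)
    also have "(\<Sum>(y, K)\<in>?P. f y * (g (Sup K) - g (Inf K)))
        = (\<Sum>i<Suc m. f (x m i) * (g (real (Suc i) * \<delta>) - g (real i * \<delta>)))"
    proof (subst sum.reindex)
      show "inj_on (\<lambda>i. (x m i, ?K i)) {..<Suc m}"
      proof (rule inj_onI)
        fix i j assume "(x m i, ?K i) = (x m j, ?K j)"
        then have "?K i = ?K j" by (simp only: prod.inject)
        then have "Inf (?K i) = Inf (?K j)" by (rule arg_cong)
        then show "i = j" unfolding Inf using \<delta> by simp
      qed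
      show "sum ((\<lambda>(y, K). f y * (g (Sup K) - g (Inf K))) \<circ> (\<lambda>i. (x m i, ?K i))) {..<Suc m}
          = (\<Sum>i<Suc m. f (x m i) * (g (real (Suc i) * \<delta>) - g (real i * \<delta>)))"
        unfolding comp_def prod.case Sup Inf by (rule refl)
    qed
    finally show "norm ((\<Sum>i<Suc m. f (x m i) * (g (real (Suc i) * (t / real (Suc m))) - g (real i * (t / real (Suc m))))) - I) < \<epsilon>"
      unfolding \<delta>_def real_norm_def .
  qed
qed

text \<open>Since the integral is the limit of the sums for every choice of tags, the tags may be adapted to
  \<open>b\<close>. They do not depend on \<open>\<omega>\<close>, so each sum is Gaussian.\<close>

lemma (in prob_space) RS_integral_fbm_sub_gaussian:
  assumes X: "fractional_brownian_motion M H X" and H: "1 / 2 \<le> H" and t: "0 < t"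
    and b2: "set_integrable lborel {0..t} (\<lambda>s. (b s)\<^sup>2)"
    and J: "J \<in> borel_measurable M"
    and RS: "AE \<omega> in M. has_RS_integral b (\<lambda>s. X s \<omega>) 0 t (J \<omega>)"
  shows "sub_gaussian M J (2 * H * t powr (2 * H - 1) * (LBINT s:{0..t}. (b s)\<^sup>2))"
proof -
  define \<delta> where "\<delta> m = t / real (Suc m)" for m
  have \<delta>: "0 < \<delta> m" and t_eq: "real (Suc m) * \<delta> m = t" for m using t by (auto simp: \<delta>_def)
  have le: "real i * \<delta> m \<le> real (Suc i) * \<delta> m" for i m using \<delta>[of m] by (intro mult_right_mono) auto
  have sub: "{real i * \<delta> m<..real (Suc i) * \<delta> m} \<subseteq> {0..t}" if "i < Suc m" for i m
  proof -
    have "real (Suc i) * \<delta> m \<le> real (Suc m) * \<delta> m" using that \<delta>[of m] by (intro mult_right_mono) auto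
    moreover have "0 \<le> real i * \<delta> m" using \<delta>[of m] by simp
    ultimately show ?thesis unfolding t_eq by auto
  qed
  \<comment> \<open>A tag at which \<open>b\<^sup>2\<close> is at most its mean over the interval.\<close>
  define x where "x m i = (SOME x. x \<in> {real i * \<delta> m..real (Suc i) * \<delta> m} \<and>
      (b x)\<^sup>2 * (real (Suc i) * \<delta> m - real i * \<delta> m) \<le> (LBINT s:{real i * \<delta> m<..real (Suc i) * \<delta> m}. (b s)\<^sup>2))" for m i
  have tag: "x m i \<in> {real i * \<delta> m..real (Suc i) * \<delta> m} \<and> (b (x m i))\<^sup>2 * (real (Suc i) * \<delta> m - real i * \<delta> m)
      \<le> (LBINT s:{real i * \<delta> m<..real (Suc i) * \<delta> m}. (b s)\<^sup>2)" if "i < Suc m" for i m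
    unfolding x_def
  proof (rule someI_ex)
    have "real i * \<delta> m < real (Suc i) * \<delta> m" using \<delta>[of m] by simp
    from set_integral_attains_mean_bound[OF this set_integrable_subset[OF b2 _ sub[OF that]]]
    show "\<exists>x. x \<in> {real i * \<delta> m..real (Suc i) * \<delta> m} \<and> (b x)\<^sup>2 * (real (Suc i) * \<delta> m - real i * \<delta> m)
      \<le> (LBINT s:{real i * \<delta> m<..real (Suc i) * \<delta> m}. (b s)\<^sup>2)" by auto
  qed
  note x = conjunct1[OF tag] and xb = conjunct2[OF tag]
  define S where "S m \<omega> = (\<Sum>i<Suc m. b (x m i) * (X (real (Suc i) * \<delta> m) \<omega> - X (real i * \<delta> m) \<omega>))" for m \<omega>
  let ?V = "2 * H * t powr (2 * H - 1) * (LBINT s:{0..t}. (b s)\<^sup>2)"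
  have S: "sub_gaussian M (S m) ?V" for m
  proof (rule sub_gaussian_mono)
    let ?v = "\<Sum>i<Suc m. \<Sum>j<Suc m. b (x m i) * b (x m j) * increment_covariance (fbm_covariance H) (\<lambda>i. real i * \<delta> m) i j"
    have "centred_gaussian_process M X (fbm_covariance H)"
      using X unfolding fractional_brownian_motion_def fbm_covariance_def[abs_def] by simp
    from centred_gaussian_process_increments[OF this, of "Suc m" "\<lambda>i. real i * \<delta> m"] \<delta>[of m]
    show "sub_gaussian M (S m) ?v"
      unfolding S_def[abs_def] by (intro centred_gaussian_sub_gaussian) (auto simp: less_imp_le)
    have "?v \<le> 2 * H * t powr (2 * H - 1) * (\<Sum>i<Suc m. (b (x m i))\<^sup>2 * \<delta> m)"
      using fbm_riemann_sum_variance[OF H less_imp_le[OF \<delta>[of m]], where n = "Suc m" and d = "\<lambda>i. b (x m i)"]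
      unfolding t_eq .
    also have "\<dots> \<le> ?V"
    proof (intro mult_left_mono)
      have "(\<Sum>i<Suc m. (b (x m i))\<^sup>2 * \<delta> m) \<le> (\<Sum>i<Suc m. LBINT s:{real i * \<delta> m<..real (Suc i) * \<delta> m}. (b s)\<^sup>2)"
        using xb[of _ m] by (intro sum_mono) (auto simp: algebra_simps)
      also have "\<dots> = (LBINT s:{real 0 * \<delta> m<..real (Suc m) * \<delta> m}. (b s)\<^sup>2)"
        using le[of _ m] by (intro set_integral_Ioc_sum set_integrable_subset[OF b2]) (auto simp: t_eq simp del: of_nat_Suc)
      also have "\<dots> \<le> (LBINT s:{0..t}. (b s)\<^sup>2)"
        using b2 unfolding t_eq
        by (intro set_integral_mono_set_nonneg) auto
      finally show "(\<Sum>i<Suc m. (b (x m i))\<^sup>2 * \<delta> m) \<le> (LBINT s:{0..t}. (b s)\<^sup>2)" .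
    qed (use H in simp)
    finally show "?v \<le> ?V" .
  qed
  show ?thesis
  proof (rule sub_gaussian_limit[where Xn = S and Q = "\<lambda>m \<omega>. ?V"])
    show "S m \<in> borel_measurable M" for m by (rule sub_gaussian_measurable[OF S])
    show "(\<integral>\<^sup>+\<omega>. ennreal (exp (\<theta> * S m \<omega> - \<theta>\<^sup>2 * ?V / 2)) \<partial>M) \<le> 1" for m \<theta>
      by (rule sub_gaussian_normalized_mgf[OF S])
    show "AE \<omega> in M. (\<lambda>m. S m \<omega>) \<longlonglongrightarrow> J \<omega>"
      using RS
    proof eventually_elim
      case (elim \<omega>)
      from has_RS_integral_uniform_sums[OF this t, of x] x show ?case
        unfolding S_def \<delta>_def by simp
    qed
  qed (use J in auto)
qed

section \<open>Exponential averages of sub-Gaussian families\<close>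

text \<open>Convexity of \<open>x \<mapsto> x\<^sup>p\<close> for \<open>x = exp y\<close>: the graph lies above the tangent at \<open>exp \<rho>\<close>.
  Integrating this over a probability measure is Jensen's inequality.\<close>

lemma exp_tangent:
  fixes p \<rho> y :: real
  assumes "1 \<le> p"
  shows "p * exp ((p - 1) * \<rho>) * exp y \<le> exp (p * y) + (p - 1) * exp (p * \<rho>)"
proof -
  have "exp ((1 - (1 - 1 / p)) *\<^sub>R (p * y) + (1 - 1 / p) *\<^sub>R (p * \<rho>))
      \<le> (1 - (1 - 1 / p)) * exp (p * y) + (1 - 1 / p) * exp (p * \<rho>)"
    using assms by (intro convex_onD[OF exp_convex]) auto
  moreover have "(1 - (1 - 1 / p)) *\<^sub>R (p * y) + (1 - 1 / p) *\<^sub>R (p * \<rho>) = (p - 1) * \<rho> + y"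
    using assms by (simp add: field_simps)
  ultimately have "exp ((p - 1) * \<rho>) * exp y \<le> (1 / p) * exp (p * y) + (1 - 1 / p) * exp (p * \<rho>)"
    by (simp only: exp_add) simp
  then have "p * (exp ((p - 1) * \<rho>) * exp y) \<le> p * ((1 / p) * exp (p * y) + (1 - 1 / p) * exp (p * \<rho>))"
    using assms by (intro mult_left_mono) auto
  also have "\<dots> = exp (p * y) + (p - 1) * exp (p * \<rho>)"
    using assms by (simp add: field_simps)
  finally show ?thesis by (simp add: mult.assoc)
qed

text \<open>A Gaussian tail for an average of exponentials, with the common variance proxy \<open>V\<close> of the single
  exponents. The threshold enters through \<open>L = ln (c / \<nu>)\<close>, and \<open>p = L / V\<close> minimises the exponent
  \<open>- p L + p\<^sup>2 V / 2\<close>; Jensen's inequality requires \<open>p \<ge> 1\<close>, hence the two cases.\<close>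

lemma (in prob_space) exp_average_tail:
  fixes Y :: "'s \<Rightarrow> 'a \<Rightarrow> real" and S :: "'s measure" and w :: "'s \<Rightarrow> real" and c V :: real
  defines "\<nu> \<equiv> \<integral>s. w s * expectation (\<lambda>\<omega>. exp (Y s \<omega>)) \<partial>S"
  assumes S: "sigma_finite_measure S"
    and w: "integrable S w" "\<And>s. 0 \<le> w s"
    and Y: "(\<lambda>(s, \<omega>). Y s \<omega>) \<in> borel_measurable (S \<Otimes>\<^sub>M M)"
    and sub: "AE s in S. 0 < w s \<longrightarrow> sub_gaussian M (Y s) V"
    and V: "0 \<le> V" and c: "\<nu> < c"
  shows "prob {\<omega> \<in> space M. c \<le> (\<integral>s. w s * exp (Y s \<omega>) \<partial>S)} \<le> exp (- ((ln (c / \<nu>))\<^sup>2 / (2 * V)))"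
proof -
  interpret S: sigma_finite_measure S by (rule S)
  interpret P: pair_sigma_finite S M ..
  note [measurable] = Y
  have wm [measurable]: "w \<in> borel_measurable S" using w(1) by measurable
  define \<Phi> where "\<Phi> p \<omega> = (\<integral>\<^sup>+s. ennreal (w s) * ennreal (exp (p * Y s \<omega>)) \<partial>S)" for p \<omega>
  have [measurable]: "\<Phi> p \<in> borel_measurable M" for p
    unfolding \<Phi>_def by measurable
  have Emeas [measurable]: "(\<lambda>s. expectation (\<lambda>\<omega>. exp (Y s \<omega>))) \<in> borel_measurable S"
    by measurable
  have E\<Phi>: "(\<integral>\<^sup>+\<omega>. \<Phi> p \<omega> \<partial>M) = (\<integral>\<^sup>+s. ennreal (w s) * (\<integral>\<^sup>+\<omega>. ennreal (exp (p * Y s \<omega>)) \<partial>M) \<partial>S)" for p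
  proof -
    have "(\<integral>\<^sup>+\<omega>. \<Phi> p \<omega> \<partial>M) = (\<integral>\<^sup>+s. \<integral>\<^sup>+\<omega>. ennreal (w s) * ennreal (exp (p * Y s \<omega>)) \<partial>M \<partial>S)"
      unfolding \<Phi>_def by (rule P.Fubini') measurable
    also have "\<dots> = (\<integral>\<^sup>+s. ennreal (w s) * (\<integral>\<^sup>+\<omega>. ennreal (exp (p * Y s \<omega>)) \<partial>M) \<partial>S)"
      by (intro nn_integral_cong nn_integral_cmult) measurable
    finally show ?thesis .
  qed
  have mgf: "AE s in S. w s \<le> w s * expectation (\<lambda>\<omega>. exp (Y s \<omega>)) \<and>
      w s * expectation (\<lambda>\<omega>. exp (Y s \<omega>)) \<le> w s * exp (V / 2)"
    using sub
  proof eventually_elim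
    case (elim s)
    show ?case
    proof (cases "w s = 0")
      case False
      then have "sub_gaussian M (Y s) V" using elim w(2)[of s] by (simp add: less_le)
      from sub_gaussian_one_le_mgf[OF this, of 1] w(2)[of s] show ?thesis
        by (auto intro: mult_left_mono simp: mult_le_cancel_left1)
    qed simp
  qed
  have int_wE: "integrable S (\<lambda>s. w s * expectation (\<lambda>\<omega>. exp (Y s \<omega>)))"
  proof (rule Bochner_Integration.integrable_bound)
    show "integrable S (\<lambda>s. w s * exp (V / 2))" using w(1) by simp
    show "AE s in S. norm (w s * expectation (\<lambda>\<omega>. exp (Y s \<omega>))) \<le> norm (w s * exp (V / 2))"
      using mgf by eventually_elim (use w(2) in \<open>auto simp: abs_mult\<close>)
  qed measurable
  have w_le_\<nu>: "(\<integral>s. w s \<partial>S) \<le> \<nu>"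
    unfolding \<nu>_def by (rule integral_mono_AE[OF w(1) int_wE]) (use mgf in auto)
  have nn_w: "(\<integral>\<^sup>+s. ennreal (w s) \<partial>S) = ennreal (\<integral>s. w s \<partial>S)"
    using w by (intro nn_integral_eq_integral) auto
  have "0 \<le> (\<integral>s. w s \<partial>S)" using w(2) by (intro integral_nonneg_AE) auto
  with w_le_\<nu> have \<nu>0: "0 \<le> \<nu>" by simp
  define E where "E = {\<omega> \<in> space M. ennreal c \<le> \<Phi> 1 \<omega>}"
  have [measurable]: "E \<in> sets M" unfolding E_def by measurable
  have sub_E: "{\<omega> \<in> space M. c \<le> (\<integral>s. w s * exp (Y s \<omega>) \<partial>S)} \<subseteq> E"
  proof safe
    fix \<omega> assume \<omega>: "\<omega> \<in> space M" and le: "c \<le> (\<integral>s. w s * exp (Y s \<omega>) \<partial>S)"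
    have "integrable S (\<lambda>s. w s * exp (Y s \<omega>))"
      using le c \<nu>0 not_integrable_integral_eq by fastforce
    then have "\<Phi> 1 \<omega> = ennreal (\<integral>s. w s * exp (Y s \<omega>) \<partial>S)"
      unfolding \<Phi>_def using w(2)
      by (subst nn_integral_eq_integral[symmetric]) (auto simp: ennreal_mult)
    then show "\<omega> \<in> E" using \<omega> le by (auto simp: E_def intro: ennreal_leI)
  qed
  have prob_E: "prob E \<le> exp (- ((ln (c / \<nu>))\<^sup>2 / (2 * V)))"
  \<comment> \<open>Division by zero yields zero, so in these degenerate cases the claimed bound is one.\<close>
  proof (cases "\<nu> = 0 \<or> V = 0")
    case True
    then show ?thesis by auto
  next
    case False
    with \<nu>0 V have pos: "0 < \<nu>" "0 < V" by auto
    with c have "0 < c" by simp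
    define L where "L = ln (c / \<nu>)"
    have L0: "0 < L" using pos c by (simp add: L_def)
    have eL: "exp L = c / \<nu>" using pos \<open>0 < c\<close> by (simp add: L_def)
    show ?thesis
    proof (cases "L \<le> V")
      case True
      have "(\<integral>\<^sup>+\<omega>. \<Phi> 1 \<omega> \<partial>M) \<le> ennreal \<nu>"
      proof -
        have "(\<integral>\<^sup>+\<omega>. \<Phi> 1 \<omega> \<partial>M) = (\<integral>\<^sup>+s. ennreal (w s * expectation (\<lambda>\<omega>. exp (Y s \<omega>))) \<partial>S)"
          unfolding E\<Phi>
        proof (rule nn_integral_cong_AE)
          show "AE s in S. ennreal (w s) * (\<integral>\<^sup>+\<omega>. ennreal (exp (1 * Y s \<omega>)) \<partial>M)
              = ennreal (w s * expectation (\<lambda>\<omega>. exp (Y s \<omega>)))"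
            using sub
          proof eventually_elim
            case (elim s)
            show ?case
            proof (cases "w s = 0")
              case False
              then have "sub_gaussian M (Y s) V" using elim w(2)[of s] by (simp add: less_le)
              from sub_gaussian_one_le_mgf(1)[OF this, of 1] w(2)[of s] show ?thesis
                by (simp add: nn_integral_eq_integral ennreal_mult)
            qed simp
          qed
        qed
        also have "\<dots> = ennreal \<nu>"
          unfolding \<nu>_def using w(2) by (intro nn_integral_eq_integral int_wE) auto
        finally show ?thesis by simp
      qed
      moreover have "ennreal c * emeasure M E \<le> (\<integral>\<^sup>+\<omega>. \<Phi> 1 \<omega> \<partial>M)"
      proof -
        have "ennreal c * emeasure M E = (\<integral>\<^sup>+\<omega>. ennreal c * indicator E \<omega> \<partial>M)"
          by (simp add: nn_integral_cmult_indicator)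
        also have "\<dots> \<le> (\<integral>\<^sup>+\<omega>. \<Phi> 1 \<omega> \<partial>M)"
          by (intro nn_integral_mono) (auto simp: E_def indicator_def)
        finally show ?thesis .
      qed
      ultimately have "ennreal (c * prob E) \<le> ennreal \<nu>"
        using \<open>0 < c\<close> by (simp add: emeasure_eq_measure ennreal_mult)
      then have "prob E \<le> \<nu> / c" using pos \<open>0 < c\<close> by (simp add: field_simps)
      also have "\<dots> = exp (- L)" using eL by (simp add: exp_minus)
      also have "\<dots> \<le> exp (- (L\<^sup>2 / (2 * V)))"
      proof -
        have "L * L \<le> L * (2 * V)" using True L0 pos by (intro mult_left_mono) auto
        then show ?thesis using pos by (simp add: power2_eq_square field_simps)
      qed
      finally show ?thesis by (simp add: L_def)
    next
      case False
      define p where "p = L / V"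
      have p1: "1 \<le> p" using False pos by (simp add: p_def)
      have low: "ennreal (exp (p * L) * \<nu>) \<le> \<Phi> p \<omega>" if "\<omega> \<in> E" for \<omega>
      proof -
        have \<omega>: "\<omega> \<in> space M" and c\<Phi>: "ennreal c \<le> \<Phi> 1 \<omega>" using that by (auto simp: E_def)
        have [measurable]: "(\<lambda>s. Y s \<omega>) \<in> borel_measurable S" using \<omega> by measurable
        \<comment> \<open>The slope, in the variable \<open>exp y\<close>, of the tangent to the \<open>p\<close>-th power at \<open>exp L\<close>.\<close>
        define k where "k = p * exp ((p - 1) * L)"
        have k0: "0 \<le> k" using p1 by (simp add: k_def)
        have "ennreal (p * exp (p * L) * \<nu>) = ennreal k * ennreal c"
        proof -
          have "k * c = p * (exp ((p - 1) * L) * exp L) * \<nu>" using eL pos by (simp add: k_def)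
          also have "exp ((p - 1) * L) * exp L = exp (p * L)" by (simp add: exp_add[symmetric] algebra_simps)
          finally show ?thesis using k0 \<open>0 < c\<close> by (simp add: ennreal_mult[symmetric])
        qed
        also have "\<dots> \<le> ennreal k * \<Phi> 1 \<omega>" by (intro mult_left_mono c\<Phi>) simp
        also have "\<dots> = (\<integral>\<^sup>+s. ennreal k * (ennreal (w s) * ennreal (exp (1 * Y s \<omega>))) \<partial>S)"
          unfolding \<Phi>_def by (rule nn_integral_cmult[symmetric]) measurable
        also have "\<dots> \<le> (\<integral>\<^sup>+s. ennreal (w s) * ennreal (exp (p * Y s \<omega>)) + ennreal ((p - 1) * exp (p * L)) * ennreal (w s) \<partial>S)"
        proof (intro nn_integral_mono)
          fix s
          have "w s * (k * exp (Y s \<omega>)) \<le> w s * (exp (p * Y s \<omega>) + (p - 1) * exp (p * L))"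
            unfolding k_def by (intro mult_left_mono exp_tangent p1 w(2))
          then have "k * (w s * exp (1 * Y s \<omega>)) \<le> w s * exp (p * Y s \<omega>) + (p - 1) * exp (p * L) * w s"
            by (simp add: algebra_simps)
          then have "ennreal (k * (w s * exp (1 * Y s \<omega>))) \<le> ennreal (w s * exp (p * Y s \<omega>) + (p - 1) * exp (p * L) * w s)"
            by (rule ennreal_leI)
          moreover have "ennreal (k * (w s * exp (1 * Y s \<omega>))) = ennreal k * (ennreal (w s) * ennreal (exp (1 * Y s \<omega>)))"
            using k0 w(2)[of s] by (simp add: ennreal_mult)
          moreover have "ennreal (w s * exp (p * Y s \<omega>) + (p - 1) * exp (p * L) * w s)
              = ennreal (w s) * ennreal (exp (p * Y s \<omega>)) + ennreal ((p - 1) * exp (p * L)) * ennreal (w s)"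
            using w(2)[of s] p1 by (subst ennreal_plus) (auto simp: ennreal_mult)
          ultimately show "ennreal k * (ennreal (w s) * ennreal (exp (1 * Y s \<omega>)))
              \<le> ennreal (w s) * ennreal (exp (p * Y s \<omega>)) + ennreal ((p - 1) * exp (p * L)) * ennreal (w s)"
            by simp
        qed
        also have "\<dots> = \<Phi> p \<omega> + ennreal ((p - 1) * exp (p * L)) * (\<integral>\<^sup>+s. ennreal (w s) \<partial>S)"
          unfolding \<Phi>_def by (subst nn_integral_add) (auto simp: nn_integral_cmult)
        also have "\<dots> \<le> \<Phi> p \<omega> + ennreal ((p - 1) * exp (p * L)) * ennreal \<nu>"
          unfolding nn_w by (intro add_left_mono mult_left_mono ennreal_leI w_le_\<nu>) simp
        finally have le: "ennreal (p * exp (p * L) * \<nu>) \<le> \<Phi> p \<omega> + ennreal ((p - 1) * exp (p * L)) * ennreal \<nu>" .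
        define rest where "rest = (p - 1) * exp (p * L) * \<nu>"
        have "0 \<le> rest" using p1 \<nu>0 by (simp add: rest_def)
        have "p * exp (p * L) * \<nu> = exp (p * L) * \<nu> + rest" by (simp add: rest_def algebra_simps)
        then have "ennreal (p * exp (p * L) * \<nu>) = ennreal rest + ennreal (exp (p * L) * \<nu>)"
          using \<open>0 \<le> rest\<close> \<nu>0 by (simp add: add.commute)
        moreover have "ennreal ((p - 1) * exp (p * L)) * ennreal \<nu> = ennreal rest"
          using p1 \<nu>0 unfolding rest_def by (subst ennreal_mult[symmetric]) auto
        ultimately have "ennreal rest + ennreal (exp (p * L) * \<nu>) \<le> ennreal rest + \<Phi> p \<omega>"
          using le by (simp add: add.commute)
        then show ?thesis by (simp add: ennreal_add_left_cancel_le)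
      qed
      have "ennreal (exp (p * L) * \<nu>) * emeasure M E = (\<integral>\<^sup>+\<omega>. ennreal (exp (p * L) * \<nu>) * indicator E \<omega> \<partial>M)"
        by (simp add: nn_integral_cmult_indicator)
      also have "\<dots> \<le> (\<integral>\<^sup>+\<omega>. \<Phi> p \<omega> \<partial>M)"
        by (intro nn_integral_mono) (auto simp: indicator_def low)
      also have "\<dots> \<le> (\<integral>\<^sup>+s. ennreal (exp (p\<^sup>2 * V / 2)) * ennreal (w s) \<partial>S)"
        unfolding E\<Phi>
      proof (rule nn_integral_mono_AE)
        show "AE s in S. ennreal (w s) * (\<integral>\<^sup>+\<omega>. ennreal (exp (p * Y s \<omega>)) \<partial>M)
            \<le> ennreal (exp (p\<^sup>2 * V / 2)) * ennreal (w s)"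
          using sub
        proof eventually_elim
          case (elim s)
          show ?case
          proof (cases "w s = 0")
            case False
            then have "sub_gaussian M (Y s) V" using elim w(2)[of s] by (simp add: less_le)
            from sub_gaussian_mgf[OF this, of p] show ?thesis
              by (subst mult.commute) (rule mult_right_mono, auto)
          qed simp
        qed
      qed
      also have "\<dots> = ennreal (exp (p\<^sup>2 * V / 2)) * (\<integral>\<^sup>+s. ennreal (w s) \<partial>S)"
        by (rule nn_integral_cmult) measurable
      also have "\<dots> \<le> ennreal (exp (p\<^sup>2 * V / 2)) * ennreal \<nu>"
        unfolding nn_w by (intro mult_left_mono ennreal_leI w_le_\<nu>) simp
      finally have "ennreal (exp (p * L) * \<nu> * prob E) \<le> ennreal (exp (p\<^sup>2 * V / 2) * \<nu>)"
        using \<nu>0 by (simp add: emeasure_eq_measure ennreal_mult)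
      then have "exp (p * L) * prob E \<le> exp (p\<^sup>2 * V / 2)" using pos by simp
      then have "prob E \<le> exp (p\<^sup>2 * V / 2) / exp (p * L)" by (simp add: field_simps)
      also have "\<dots> = exp (- (L\<^sup>2 / (2 * V)))"
        using pos by (simp add: exp_diff[symmetric] p_def power2_eq_square field_simps)
      finally show ?thesis by (simp add: L_def)
    qed
  qed
  have "prob {\<omega> \<in> space M. c \<le> (\<integral>s. w s * exp (Y s \<omega>) \<partial>S)} \<le> prob E"
    by (rule finite_measure_mono[OF sub_E]) measurable
  with prob_E show ?thesis by simp
qed

section \<open>The noise, its exponential functional and the hitting time\<close>

text \<open>The process \<open>N t\<close> is measurable whereas the pathwise integral \<open>J t\<close> is known only up to null sets;
  the difference \<open>N t - I t\<close> is a measurable version of it.\<close>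

lemma noise_process_sub_gaussian:
  assumes fil: "filtered_prob_space M F" and BM: "brownian_motion M F B"
    and X: "fractional_brownian_motion M H X" and H: "1 / 2 \<le> H"
    and N: "noise_process M F B X a b N" and t: "0 < t"
    and a2: "set_integrable lborel {0..t} (\<lambda>s. (a s)\<^sup>2)"
    and b2: "set_integrable lborel {0..t} (\<lambda>s. (b s)\<^sup>2)"
  shows "sub_gaussian M (N t) (2 * ((LBINT s:{0..t}. (a s)\<^sup>2)
    + 2 * H * t powr (2 * H - 1) * (LBINT s:{0..t}. (b s)\<^sup>2)))"
proof -
  interpret prob_space M using fil by (simp add: filtered_prob_space_def)
  obtain I J where I: "\<forall>t\<ge>0. ito_integral M F B (\<lambda>s \<omega>. a s) t (I t)"
    and J: "AE \<omega> in M. \<forall>t\<ge>0. has_RS_integral b (\<lambda>s. X s \<omega>) 0 t (J t \<omega>)"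
    and sum: "\<forall>t\<ge>0. AE \<omega> in M. N t \<omega> = I t \<omega> + J t \<omega>"
    using N unfolding noise_process_def by blast
  have Nm [measurable]: "N t \<in> borel_measurable M" using N t by (simp add: noise_process_def)
  have Isub: "sub_gaussian M (I t) (LBINT s:{0..t}. (a s)\<^sup>2)"
    using t I a2 by (intro ito_integral_sub_gaussian[OF fil BM]) auto
  note [measurable] = sub_gaussian_measurable[OF Isub]
  have "AE \<omega> in M. has_RS_integral b (\<lambda>s. X s \<omega>) 0 t (N t \<omega> - I t \<omega>)"
  proof -
    have "AE \<omega> in M. N t \<omega> = I t \<omega> + J t \<omega>" using sum t by simp
    with J show ?thesis
    proof eventually_elim
      case (elim \<omega>)
      then have "N t \<omega> - I t \<omega> = J t \<omega>" by simp
      then show ?case using elim t by simp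
    qed
  qed
  then have "sub_gaussian M (\<lambda>\<omega>. N t \<omega> - I t \<omega>) (2 * H * t powr (2 * H - 1) * (LBINT s:{0..t}. (b s)\<^sup>2))"
    using X H t b2 by (intro RS_integral_fbm_sub_gaussian) auto
  from sub_gaussian_add[OF Isub this] show ?thesis by simp
qed

text \<open>The path is the limit of the step functions that freeze it at the preceding multiple of
  \<open>1 / Suc n\<close>. Time is cut off at \<open>0\<close> because the process is controlled only at nonnegative times.\<close>

lemma continuous_process_jointly_measurable:
  fixes N :: "real \<Rightarrow> 'w \<Rightarrow> real"
  assumes N: "\<And>t. 0 \<le> t \<Longrightarrow> N t \<in> borel_measurable M"
    and cont: "\<And>\<omega>. \<omega> \<in> space M \<Longrightarrow> continuous_on {0..} (\<lambda>t. N t \<omega>)"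
  shows "(\<lambda>(s, \<omega>). N (max 0 s) \<omega>) \<in> borel_measurable (lborel \<Otimes>\<^sub>M M)"
proof -
  let ?g = "\<lambda>n s. real (nat \<lfloor>max 0 s * real (Suc n)\<rfloor>) / real (Suc n)"
  have "(\<lambda>x. N (max 0 (fst x)) (snd x)) \<in> borel_measurable (lborel \<Otimes>\<^sub>M M)"
  proof (rule borel_measurable_LIMSEQ_real)
    fix x :: "real \<times> 'w" assume "x \<in> space (lborel \<Otimes>\<^sub>M M)"
    then have \<omega>: "snd x \<in> space M" by (auto simp: space_pair_measure)
    have "(\<lambda>n. ?g n (fst x)) \<longlonglongrightarrow> max 0 (fst x)"
    proof (rule LIM_zero_cancel, rule Lim_null_comparison)
      show "\<forall>\<^sub>F n in sequentially. norm (?g n (fst x) - max 0 (fst x)) \<le> 1 / real (Suc n)"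
      proof (rule always_eventually, rule allI)
        fix n
        let ?y = "max 0 (fst x) * real (Suc n)"
        have "real (nat \<lfloor>?y\<rfloor>) = of_int \<lfloor>?y\<rfloor>" by simp
        then have "\<bar>real (nat \<lfloor>?y\<rfloor>) - ?y\<bar> \<le> 1" by linarith
        then have "\<bar>real (nat \<lfloor>?y\<rfloor>) - ?y\<bar> / real (Suc n) \<le> 1 / real (Suc n)" by (intro divide_right_mono) auto
        moreover have "?g n (fst x) - max 0 (fst x) = (real (nat \<lfloor>?y\<rfloor>) - ?y) / real (Suc n)"
          by (simp add: diff_divide_distrib del: of_nat_Suc)
        ultimately show "norm (?g n (fst x) - max 0 (fst x)) \<le> 1 / real (Suc n)" by (simp del: of_nat_Suc)
      qed
      show "(\<lambda>n. 1 / real (Suc n)) \<longlonglongrightarrow> 0"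
        using LIMSEQ_inverse_real_of_nat by (simp add: inverse_eq_divide)
    qed
    then show "(\<lambda>n. N (?g n (fst x)) (snd x)) \<longlonglongrightarrow> N (max 0 (fst x)) (snd x)"
      by (rule continuous_on_tendsto_compose[OF cont[OF \<omega>]]) (auto simp del: of_nat_Suc)
  next
    fix n
    show "(\<lambda>x. N (?g n (fst x)) (snd x)) \<in> borel_measurable (lborel \<Otimes>\<^sub>M M)"
    proof (rule measurable_compose_countable[where f = "\<lambda>i x. N (real i / real (Suc n)) (snd x)"])
      show "(\<lambda>x. N (real i / real (Suc n)) (snd x)) \<in> borel_measurable (lborel \<Otimes>\<^sub>M M)" for i
        by (rule measurable_compose[OF measurable_snd N]) simp
      show "(\<lambda>x. nat \<lfloor>max 0 (fst x) * real (Suc n)\<rfloor>) \<in> measurable (lborel \<Otimes>\<^sub>M M) (count_space UNIV)"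
        by measurable
    qed
  qed
  then show ?thesis by (simp add: case_prod_beta)
qed

lemma mono_set_integral_Icc:
  fixes f :: "real \<Rightarrow> real"
  assumes f: "\<And>t. 0 \<le> t \<Longrightarrow> set_integrable lborel {0..t} f" and nonneg: "\<And>s. 0 \<le> f s"
  shows "mono (\<lambda>t. LBINT s:{0..t}. f s)"
proof (rule monoI)
  fix s t :: real assume "s \<le> t"
  show "(LBINT r:{0..s}. f r) \<le> (LBINT r:{0..t}. f r)"
  proof (cases "0 \<le> t")
    case True
    then show ?thesis using \<open>s \<le> t\<close> nonneg by (intro set_integral_mono_set_nonneg f) auto
  next
    case False
    then show ?thesis using \<open>s \<le> t\<close> by (simp add: set_lebesgue_integral_def)
  qed
qed

text \<open>Right-continuity of the indefinite integral: the level is reached before every \<open>T + 1 / Suc n\<close>,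
  and the integrals up to these times converge to the integral up to \<open>T\<close>.\<close>

lemma set_integral_Icc_hitting_time:
  fixes f :: "real \<Rightarrow> real"
  assumes f: "\<And>t. 0 \<le> t \<Longrightarrow> set_integrable lborel {0..t} f" and nonneg: "\<And>s. 0 \<le> f s"
    and T: "0 \<le> T" and hit: "Inf (ereal ` {t. 0 < t \<and> c \<le> (LBINT s:{0..t}. f s)}) \<le> ereal T"
  shows "c \<le> (LBINT s:{0..T}. f s)"
proof -
  let ?G = "\<lambda>t. LBINT s:{0..t}. f s"
  let ?A = "\<lambda>n. {0..T + 1 / real (Suc n)}"
  have mono: "mono ?G" using f nonneg by (rule mono_set_integral_Icc)
  have c_le: "c \<le> ?G (T + 1 / real (Suc n))" for n
  proof -
    have "Inf (ereal ` {t. 0 < t \<and> c \<le> ?G t}) < ereal (T + 1 / real (Suc n))"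
      using hit by (rule le_less_trans) simp
    then obtain t where t: "0 < t" "c \<le> ?G t" "t < T + 1 / real (Suc n)"
      by (auto simp: Inf_less_iff)
    note t(2)
    also have "?G t \<le> ?G (T + 1 / real (Suc n))"
      using t(3) by (intro monoD[OF mono]) simp
    finally show ?thesis .
  qed
  have "(\<lambda>n. LBINT s:?A n. f s) \<longlonglongrightarrow> (LBINT s:(\<Inter>n. ?A n). f s)"
  proof (rule set_integral_cont_down)
    show "decseq ?A"
    proof (rule decseq_SucI)
      fix n
      have "1 / real (Suc (Suc n)) \<le> 1 / real (Suc n)" by (intro frac_le) auto
      then show "?A (Suc n) \<subseteq> ?A n" by (simp del: of_nat_Suc)
    qed
    show "set_integrable lborel (?A 0) f" using T by (intro f) simp
  qed simp
  moreover have "(\<Inter>n. ?A n) = {0..T}"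
  proof (rule set_eqI)
    fix s
    have "s \<le> T" if "\<And>n. s \<le> T + 1 / real (Suc n)"
    proof (rule field_le_epsilon)
      fix e :: real assume "0 < e"
      then obtain n where "inverse (real (Suc n)) < e" using reals_Archimedean by blast
      then show "s \<le> T + e" using that[of n] by (simp add: inverse_eq_divide)
    qed
    moreover have "s \<le> T + 1 / real (Suc n)" if "s \<le> T" for n using that by (simp add: add_increasing2)
    ultimately have "s \<le> T \<longleftrightarrow> (\<forall>n. s \<le> T + 1 / real (Suc n))" by blast
    then show "s \<in> (\<Inter>n. ?A n) \<longleftrightarrow> s \<in> {0..T}" by (simp del: of_nat_Suc)
  qed
  ultimately have "(\<lambda>n. LBINT s:?A n. f s) \<longlonglongrightarrow> ?G T" by simp
  then show ?thesis by (rule LIMSEQ_le_const) (use c_le in auto)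
qed

theorem theorem4p1:
  fixes D U :: "(real ^ 'd) set"
    and \<nu>0 \<beta> \<psi>1 v0 \<zeta> :: "real ^ 'd \<Rightarrow> real"
    and g :: "real ^ 'd \<Rightarrow> real \<Rightarrow> real"
    and \<mu>1 lam \<gamma> \<eta>1 \<zeta>m H T :: real
    and a b k K A :: "real \<Rightarrow> real"
    and M :: "'w measure" and F :: "real \<Rightarrow> 'w measure"
    and B BH N :: "real \<Rightarrow> 'w \<Rightarrow> real"
    and c :: real
    and \<tau> :: "'w \<Rightarrow> ereal"
    and \<nu> MM :: "real \<Rightarrow> real"
  assumes "open D" and "compact (frontier D)" and "lipschitz_boundary D"
    and "symmetric_levy_density \<nu>0"
    and "open U" and "bounded U" and "robin_coefficient \<nu>0 D U \<beta>"
    and "first_robin_eigenpair \<nu>0 D \<beta> \<mu>1 \<psi>1"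
    and "0 < \<mu>1" and "AE x in lborel. x \<in> D \<longrightarrow> 0 < \<psi>1 x" and "(LINT x:D|lborel. \<psi>1 x) = 1"
    and "filtered_prob_space M F" and "brownian_motion M F B"
    and "1 / 2 < H" and "H < 1" and "fractional_brownian_motion M H BH"
    and volterra: "\<forall>t\<ge>0. ito_integral M F B (\<lambda>s \<omega>. volterra_kernel H t s) t (BH t)"
    and "\<forall>t>0. 0 < a t \<and> 0 < b t \<and> 0 < k t"
    and "\<forall>t\<ge>0. set_integrable lborel {0..t} (\<lambda>s. (a s)\<^sup>2)"
    and "\<forall>t\<ge>0. set_integrable lborel {0..t} (\<lambda>s. (b s)\<^sup>2)"
    and "\<forall>t\<ge>0. set_integrable lborel {0..t} (\<lambda>s. (k s)\<^sup>2)"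
    and "noise_process M F B BH a b N"
    and K_def: "\<forall>t. K t = 1 / 2 * (LBINT s:{0..t}. (k s)\<^sup>2)"
    and A_def: "\<forall>t. A t = 1 / 2 * (LBINT s:{0..t}. (a s)\<^sup>2)"
    and "0 < lam" and "0 < \<gamma>" and "0 < \<eta>1"
    and "\<forall>x\<in>closure D. 0 < \<zeta> x"
    and \<zeta>m_min: "\<zeta>m \<in> \<zeta> ` closure D" "\<forall>x\<in>closure D. \<zeta>m \<le> \<zeta> x"
    and growth: "\<forall>x\<in>D. \<forall>u>0. \<eta>1 * (lam * \<zeta> x / u\<^sup>2 - \<gamma> * u) \<le> g x u"
    and "set_borel_measurable lborel D v0" and "\<forall>x\<in>D. 0 \<le> v0 x \<and> v0 x < 1"
    and c_def: "c = (L2_inner D v0 \<psi>1) ^ 3 / (3 * lam * \<eta>1 * \<zeta>m)"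
    and \<tau>_def: "\<forall>\<omega>. \<tau> \<omega> = Inf (ereal ` {t. 0 < t \<and>
       c \<le> (LBINT s:{0..t}. exp (- 3 * (\<eta>1 * \<gamma> * s - \<mu>1 * K s - A s) + 3 * N s \<omega>))})"
    and \<nu>_def: "\<forall>T. \<nu> T = (LBINT t:{0..T}.
       exp (- 3 * (\<gamma> * \<eta>1 * t - \<mu>1 * K t - A t)) * (\<integral>\<omega>. exp (3 * N t \<omega>) \<partial>M))"
    and MM_def: "\<forall>T. MM T = 18 * (LBINT s:{0..T}. (a s)\<^sup>2)
       + 36 * H * T powr (2 * H - 1) * (LBINT s:{0..T}. (b s)\<^sup>2)"
    and "0 < T" and "\<nu> T < c"
  shows "measure M {\<omega> \<in> space M. \<tau> \<omega> \<le> ereal T}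
    \<le> 2 * exp (- ((ln ((L2_inner D v0 \<psi>1) ^ 3 / (3 * lam * \<eta>1 * \<zeta>m * \<nu> T)))\<^sup>2 / (2 * MM T)))"
proof -
  have fil: "filtered_prob_space M F" and BM: "brownian_motion M F B"
    and fbm: "fractional_brownian_motion M H BH" and H: "1 / 2 < H"
    and noise: "noise_process M F B BH a b N" and \<mu>1: "0 < \<mu>1" and T: "0 < T" and \<nu>c: "\<nu> T < c"
    and pos: "0 < \<gamma>" "0 < \<eta>1" by fact+
  have a2: "set_integrable lborel {0..t} (\<lambda>s. (a s)\<^sup>2)" and b2: "set_integrable lborel {0..t} (\<lambda>s. (b s)\<^sup>2)"
    and k2: "set_integrable lborel {0..t} (\<lambda>s. (k s)\<^sup>2)" if "0 \<le> t" for t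
    using assms that by auto
  interpret prob_space M using fil by (simp add: filtered_prob_space_def)
  have Nm: "N t \<in> borel_measurable M" if "0 \<le> t" for t
    using noise that by (simp add: noise_process_def)
  have Ncont: "continuous_on {0..} (\<lambda>t. N t \<omega>)" if "\<omega> \<in> space M" for \<omega>
    using noise that by (simp add: noise_process_def)
  have amono: "mono (\<lambda>t. LBINT s:{0..t}. (a s)\<^sup>2)" and bmono: "mono (\<lambda>t. LBINT s:{0..t}. (b s)\<^sup>2)"
    and kmono: "mono (\<lambda>t. LBINT s:{0..t}. (k s)\<^sup>2)"
    by (intro mono_set_integral_Icc a2 b2 k2; simp)+
  have a0: "0 \<le> (LBINT s:{0..t}. (a s)\<^sup>2)" and b0: "0 \<le> (LBINT s:{0..t}. (b s)\<^sup>2)" for t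
    unfolding set_lebesgue_integral_def by (auto intro!: integral_nonneg_AE)
  have K: "mono K" and A: "mono A" using kmono amono by (auto simp: mono_def K_def A_def)
  \<comment> \<open>The measurability of \<open>h\<close> comes from the monotonicity of \<open>K\<close> and \<open>A\<close>.\<close>
  define h where "h s = - 3 * (\<eta>1 * \<gamma> * s - \<mu>1 * K s - A s)" for s
  have [measurable]: "h \<in> borel_measurable borel"
    using borel_measurable_mono[OF K] borel_measurable_mono[OF A] unfolding h_def by measurable
  have h_le: "h s \<le> 3 * (\<mu>1 * K t + A t)" if "0 \<le> s" "s \<le> t" for s t
  proof -
    have "K s \<le> K t" "A s \<le> A t" using K A that by (auto dest: monoD)
    then have "3 * (\<mu>1 * K s + A s) \<le> 3 * (\<mu>1 * K t + A t)"
      using \<mu>1 by (intro mult_left_mono add_mono) auto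
    moreover have "h s = 3 * (\<mu>1 * K s + A s) - 3 * (\<eta>1 * \<gamma> * s)" by (simp add: h_def algebra_simps)
    moreover have "0 \<le> 3 * (\<eta>1 * \<gamma> * s)" using pos that by simp
    ultimately show ?thesis by (simp only: diff_le_eq add_increasing2)
  qed
  define Y where "Y s \<omega> = 3 * N (max 0 s) \<omega>" for s \<omega>
  have Y: "(\<lambda>(s, \<omega>). Y s \<omega>) \<in> borel_measurable (lborel \<Otimes>\<^sub>M M)"
  proof -
    have "(\<lambda>(s, \<omega>). N (max 0 s) \<omega>) \<in> borel_measurable (lborel \<Otimes>\<^sub>M M)"
      by (rule continuous_process_jointly_measurable[where N = N and M = M, OF Nm Ncont])
    then have "(\<lambda>x. 3 * (case x of (s, \<omega>) \<Rightarrow> N (max 0 s) \<omega>)) \<in> borel_measurable (lborel \<Otimes>\<^sub>M M)"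
      by (intro borel_measurable_times borel_measurable_const)
    also have "(\<lambda>x. 3 * (case x of (s, \<omega>) \<Rightarrow> N (max 0 s) \<omega>)) = (\<lambda>(s, \<omega>). Y s \<omega>)"
      by (rule ext) (auto simp: Y_def)
    finally show ?thesis .
  qed
  define w where "w s = indicator {0..T} s * exp (h s)" for s
  have w: "integrable lborel w" "\<And>s. 0 \<le> w s"
  proof -
    show "integrable lborel w"
    proof (rule integrableI_bounded_set[where A = "{0..T}" and B = "exp (3 * (\<mu>1 * K T + A T))"])
      show "AE s in lborel. s \<in> {0..T} \<longrightarrow> norm (w s) \<le> exp (3 * (\<mu>1 * K T + A T))"
        using h_le by (auto intro!: AE_I2 simp: w_def)
    qed (use T in \<open>auto simp: w_def[abs_def]\<close>)
    show "0 \<le> w s" for s by (simp add: w_def)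
  qed
  have MM0: "0 \<le> MM T" 
    unfolding MM_def[rule_format] using H by (intro add_nonneg_nonneg mult_nonneg_nonneg a0 b0) auto
  have sub: "sub_gaussian M (Y s) (MM T)" if "0 < s" "s \<le> T" for s
  proof -
    let ?v = "2 * ((LBINT r:{0..s}. (a r)\<^sup>2) + 2 * H * s powr (2 * H - 1) * (LBINT r:{0..s}. (b r)\<^sup>2))"
    have "sub_gaussian M (N s) ?v"
      using that H by (intro noise_process_sub_gaussian[OF fil BM fbm _ noise] a2 b2) auto
    from sub_gaussian_scale[OF this, of 3] have "sub_gaussian M (Y s) (9 * ?v)"
      using that by (simp add: Y_def[abs_def])
    \<comment> \<open>Nine is the square of the factor in the exponent \<open>3 N\<^sub>s\<close>.\<close>
    moreover have "9 * ?v \<le> MM T"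
    proof -
      have "(LBINT r:{0..s}. (a r)\<^sup>2) \<le> (LBINT r:{0..T}. (a r)\<^sup>2)" using amono that by (auto dest: monoD)
      moreover have "H * s powr (2 * H - 1) * (LBINT r:{0..s}. (b r)\<^sup>2)
          \<le> H * T powr (2 * H - 1) * (LBINT r:{0..T}. (b r)\<^sup>2)"
        using that H b0 bmono by (intro mult_mono powr_mono2) (auto dest: monoD)
      ultimately show ?thesis unfolding MM_def[rule_format] by simp
    qed
    ultimately show ?thesis by (rule sub_gaussian_mono)
  qed
  have \<nu>_eq: "\<nu> T = (\<integral>s. w s * expectation (\<lambda>\<omega>. exp (Y s \<omega>)) \<partial>lborel)"
    unfolding \<nu>_def[rule_format] set_lebesgue_integral_def
    by (intro Bochner_Integration.integral_cong)
       (simp_all add: w_def h_def Y_def indicator_def mult.commute[of \<gamma>])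
  have tail: "prob {\<omega> \<in> space M. c \<le> (\<integral>s. w s * exp (Y s \<omega>) \<partial>lborel)} \<le> exp (- ((ln (c / \<nu> T))\<^sup>2 / (2 * MM T)))"
    unfolding \<nu>_eq
  proof (rule exp_average_tail)
    show "sigma_finite_measure (lborel :: real measure)" by unfold_locales
    show "AE s in lborel. 0 < w s \<longrightarrow> sub_gaussian M (Y s) (MM T)"
      \<comment> \<open>The proxy bound is available at positive times; the time \<open>0\<close> is a null set.\<close>
      using AE_lborel_singleton[of 0]
    proof eventually_elim
      case (elim s)
      then show ?case using sub[of s] by (auto simp: w_def indicator_def)
    qed
    show "(\<integral>s. w s * expectation (\<lambda>\<omega>. exp (Y s \<omega>)) \<partial>lborel) < c" using \<nu>c by (simp only: \<nu>_eq)
  qed (fact w Y MM0)+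
  have tau_le: "prob {\<omega> \<in> space M. \<tau> \<omega> \<le> ereal T} \<le> prob {\<omega> \<in> space M. c \<le> (\<integral>s. w s * exp (Y s \<omega>) \<partial>lborel)}"
  proof (rule finite_measure_mono)
    show "{\<omega> \<in> space M. \<tau> \<omega> \<le> ereal T} \<subseteq> {\<omega> \<in> space M. c \<le> (\<integral>s. w s * exp (Y s \<omega>) \<partial>lborel)}"
    proof safe
      fix \<omega> assume \<omega>: "\<omega> \<in> space M" and \<tau>: "\<tau> \<omega> \<le> ereal T"
      have [measurable]: "(\<lambda>s. Y s \<omega>) \<in> borel_measurable borel"
        using measurable_Pair1[OF Y \<omega>] by simp
      have int: "set_integrable lborel {0..t} (\<lambda>s. exp (h s + Y s \<omega>))" if "0 \<le> t" for t
      proof -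
        have "compact ((\<lambda>s. N s \<omega>) ` {0..t})"
          using continuous_on_subset[OF Ncont[OF \<omega>]] by (intro compact_continuous_image) auto
        then have "bdd_above ((\<lambda>s. N s \<omega>) ` {0..t})"
          by (intro bounded_imp_bdd_above compact_imp_bounded)
        then obtain C where C: "\<And>s. s \<in> {0..t} \<Longrightarrow> N s \<omega> \<le> C"
          unfolding bdd_above_def by blast
        show ?thesis
          unfolding set_integrable_def
        proof (rule integrableI_bounded_set[where A = "{0..t}" and B = "exp (3 * (\<mu>1 * K t + A t) + 3 * C)"])
          show "AE s in lborel. s \<in> {0..t} \<longrightarrow> norm (indicator {0..t} s *\<^sub>R exp (h s + Y s \<omega>)) \<le> exp (3 * (\<mu>1 * K t + A t) + 3 * C)"
          proof (rule AE_I2, rule impI)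
            fix s assume s: "s \<in> {0..t}"
            then have "h s + Y s \<omega> \<le> 3 * (\<mu>1 * K t + A t) + 3 * C"
              using C[OF s] h_le[of s t] by (intro add_mono) (auto simp: Y_def)
            then show "norm (indicator {0..t} s *\<^sub>R exp (h s + Y s \<omega>)) \<le> exp (3 * (\<mu>1 * K t + A t) + 3 * C)"
              using s by simp
          qed
        qed (use that in auto)
      qed
      have eq: "(LBINT s:{0..t}. exp (- 3 * (\<eta>1 * \<gamma> * s - \<mu>1 * K s - A s) + 3 * N s \<omega>))
          = (LBINT s:{0..t}. exp (h s + Y s \<omega>))" for t
        by (rule set_lebesgue_integral_cong) (auto simp: h_def Y_def)
      have "c \<le> (LBINT s:{0..T}. exp (h s + Y s \<omega>))"
        using T \<tau>[unfolded \<tau>_def[rule_format] eq] by (intro set_integral_Icc_hitting_time int) simp_all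
      also have "\<dots> = (\<integral>s. w s * exp (Y s \<omega>) \<partial>lborel)"
        unfolding set_lebesgue_integral_def
        by (intro Bochner_Integration.integral_cong) (simp_all add: w_def exp_add)
      finally show "c \<le> (\<integral>s. w s * exp (Y s \<omega>) \<partial>lborel)" .
    qed
    have "(\<lambda>\<omega>. \<integral>s. w s * exp (Y s \<omega>) \<partial>lborel) \<in> borel_measurable M"
    proof -
      have [measurable]: "w \<in> borel_measurable borel" unfolding w_def by measurable
      have "(\<lambda>(\<omega>, s). Y s \<omega>) \<in> borel_measurable (M \<Otimes>\<^sub>M lborel)"
        using measurable_pair_swap[OF Y] by simp
      note [measurable] = this
      show ?thesis by measurable
    qed
    then show "{\<omega> \<in> space M. c \<le> (\<integral>s. w s * exp (Y s \<omega>) \<partial>lborel)} \<in> events" by measurable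
  qed
  have ratio: "c / \<nu> T = L2_inner D v0 \<psi>1 ^ 3 / (3 * lam * \<eta>1 * \<zeta>m * \<nu> T)"
    by (simp add: c_def)
  note tau_le
  also note tail
  also have "exp (- ((ln (c / \<nu> T))\<^sup>2 / (2 * MM T))) \<le> 2 * exp (- ((ln (c / \<nu> T))\<^sup>2 / (2 * MM T)))"
    by simp
  finally show ?thesis unfolding ratio .
qed

end
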